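(* Fix two integers $\underline r<\bar r-1$ and an open domain $O\subseteq\mathbb R^2$. Let $K_r=K_{\eta,\zeta,r}$ be a family of kernels, defined for $r\in\{\underline r,\underline r+1,\dots,\bar r\}$ and $(\eta,\zeta)\in O$, acting on $\oplus_n\ell^2(\mathbb Z_{>0})$, and suppose that the ($n\times n$ matrix valued) kernel $K_r(u,v)$ satisfies, for all $u,v>0$, (1) $K_{r+1}(u,v)=K_r(u+1,v+1)$ for $r\in\{\underline r,\dots,\bar r-1\}$; (2) $\partial_\eta K_r(u,v)=K_{r-1}(u+1,v)-K_r(u+1,v)$ for $r\in\{\underline r+1,\dots,\bar r\}$; (3) $\partial_\zeta K_r(u,v)=K_{r-1}(u,v+1)-K_r(u,v+1)$ for $r\in\{\underline r+1,\dots,\bar r\}$. Assume that, for all $r\in\{\underline r,\dots,\bar r\}$ and fixed $(\eta,\zeta)\in O$, $K_r$ is trace class as an operator on $\oplus_n\ell^2(\mathbb Z_{>0})$, and that for such $r$ the derivatives in (2) and (3) exist in trace norm. Assume furthermore that $I-K_r$ is invertible for all $r\in\{\underline r,\dots,\bar r\}$, and define the invertible $n\times n$ matrix $$Q_r=(I-K_r)^{-1}(1,1).$$ Then for $r\in\{\underline r+1,\dots,\bar r-1\}$ and $(\eta,\zeta)\in O$, $Q_r$ satisfies the non-Abelian 2D Toda equation $$\partial_\zeta\big(\partial_\eta Q_r\,Q_r^{-1}\big)+Q_rQ_{r-1}^{-1}-Q_{r+1}Q_r^{-1}=0.$$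
   Context: $\oplus_n\ell^2(\mathbb Z_{>0})$ is the $n$-fold direct sum of $\ell^2(\mathbb Z_{>0})$. An operator $A$ on it is identified with its matrix kernel: $A(u,v)$, $u,v\in\mathbb Z_{>0}$, is the $n\times n$ matrix with entries $A_{ij}(u,v)$, and $(Af)_i(u)=\sum_j\sum_{v>0}A_{ij}(u,v)f_j(v)$. Thus $(I-K_r)^{-1}(1,1)$ is the $n\times n$ matrix obtained by evaluating the matrix kernel of $(I-K_r)^{-1}$ at $u=v=1$. Products such as $\partial_\eta Q_r\,Q_r^{-1}$ are matrix products of $\partial_\eta Q_r$ with $Q_r^{-1}$.
   Formalization: At r = r̲+1 the equation is proved only where also ∂_ζK_r̲(u+1,v) = K_r̲(u,v) − K_r̲(u+1,v+1) for all u,v>0 (relation (3) at r = r̲ via (1)); without it the claim fails there. Invertibility of Q_r is proved for r ≤ r̄−1 only; it can fail at r = r̄. *)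

theory Defs
  imports "HOL-Analysis.Analysis"
begin

text \<open>
  Elements of the \<open>n\<close>-fold direct sum of $\ell^2(\mathbb{Z}_{>0})$ are functions on \<open>nat\<close> with values
  in \<open>complex ^ 'n\<close>, \<open>n = CARD('n)\<close>; operators are given by their matrix kernels. The index set is
  \<open>{0<..}\<close>: values at the index \<open>0\<close> are junk and never enter, so equality of two sequences or of
  two operators always means equality at positive indices. Scalars are complex; kernels with
  real entries are a special case.
\<close>

type_synonym 'n kernel = "nat \<Rightarrow> nat \<Rightarrow> complex ^ 'n ^ 'n"

definition ell2 :: "(nat \<Rightarrow> complex ^ 'n::finite) set" where
  "ell2 = {f. (\<lambda>u. (norm (f u))\<^sup>2) summable_on {0<..}}"

definition ell2_norm :: "(nat \<Rightarrow> complex ^ 'n::finite) \<Rightarrow> real" where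
  "ell2_norm f = sqrt (\<Sum>\<^sub>\<infinity>u\<in>{0<..}. (norm (f u))\<^sup>2)"

definition ell2_inner ::
    "(nat \<Rightarrow> complex ^ 'n::finite) \<Rightarrow> (nat \<Rightarrow> complex ^ 'n) \<Rightarrow> complex" where
  "ell2_inner f g = (\<Sum>\<^sub>\<infinity>u\<in>{0<..}. \<Sum>i\<in>UNIV. cnj (f u $ i) * g u $ i)"

definition kapply ::
    "'n::finite kernel \<Rightarrow> (nat \<Rightarrow> complex ^ 'n) \<Rightarrow> nat \<Rightarrow> complex ^ 'n" where
  "kapply A f u = (\<Sum>\<^sub>\<infinity>v\<in>{0<..}. A u v *v f v)"

definition bounded_kernel :: "'n::finite kernel \<Rightarrow> bool" where
  "bounded_kernel A \<longleftrightarrow>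
     (\<forall>f\<in>ell2. (\<forall>u>0. (\<lambda>v. A u v *v f v) summable_on {0<..}) \<and> kapply A f \<in> ell2) \<and>
     (\<exists>C. \<forall>f\<in>ell2. ell2_norm (kapply A f) \<le> C * ell2_norm f)"

definition kadjoint :: "'n::finite kernel \<Rightarrow> 'n kernel" where
  "kadjoint A u v = (\<chi> i j. cnj (A v u $ j $ i))"

definition positive_kernel :: "'n::finite kernel \<Rightarrow> bool" where
  "positive_kernel B \<longleftrightarrow>
     bounded_kernel B \<and> (\<forall>f\<in>ell2. ell2_inner f (kapply B f) \<in> \<real>\<^sub>\<ge>\<^sub>0)"

text \<open>\<open>is_kabs A B\<close>: \<open>B\<close> is $|A| = \sqrt{A^*A}$, the (unique) positive square root of $A^*A$.\<close>

definition is_kabs :: "'n::finite kernel \<Rightarrow> 'n kernel \<Rightarrow> bool" where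
  "is_kabs A B \<longleftrightarrow> positive_kernel B \<and>
     (\<forall>f\<in>ell2. \<forall>u>0. kapply B (kapply B f) u = kapply (kadjoint A) (kapply A f) u)"

text \<open>
  \<open>has_trace_norm A t\<close>: \<open>A\<close> is trace class and $\|A\|_1 = \mathrm{tr}\,|A| = t$. The trace is the
  sum of all diagonal entries of the kernel of $|A|$, taken block by block.
\<close>

definition has_trace_norm :: "'n::finite kernel \<Rightarrow> real \<Rightarrow> bool" where
  "has_trace_norm A t \<longleftrightarrow> bounded_kernel A \<and>
     (\<exists>B. is_kabs A B \<and> ((\<lambda>u. trace (B u u)) has_sum complex_of_real t) {0<..})"

definition trace_class :: "'n::finite kernel \<Rightarrow> bool" where
  "trace_class A \<longleftrightarrow> (\<exists>t. has_trace_norm A t)"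

definition has_trace_norm_derivative ::
    "(real \<Rightarrow> 'n::finite kernel) \<Rightarrow> 'n kernel \<Rightarrow> real \<Rightarrow> bool" where
  "has_trace_norm_derivative F D x \<longleftrightarrow> trace_class D \<and>
     (\<forall>\<epsilon>>0. \<forall>\<^sub>F y in at x. \<exists>t<\<epsilon>.
        has_trace_norm (\<lambda>u v. (F y u v - F x u v) /\<^sub>R (y - x) - D u v) t)"

definition id_minus :: "'n::finite kernel \<Rightarrow> 'n kernel" where
  "id_minus A u v = (if u = v then mat 1 else 0) - A u v"

definition is_kinverse :: "'n::finite kernel \<Rightarrow> 'n kernel \<Rightarrow> bool" where
  "is_kinverse A L \<longleftrightarrow> bounded_kernel L \<and>
     (\<forall>f\<in>ell2. \<forall>u>0. kapply L (kapply A f) u = f u \<and> kapply A (kapply L f) u = f u)"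

definition kinvertible :: "'n::finite kernel \<Rightarrow> bool" where
  "kinvertible A \<longleftrightarrow> bounded_kernel A \<and> (\<exists>L. is_kinverse A L)"

text \<open>The inverse kernel is unique only at positive indices, hence \<open>SOME\<close> rather than \<open>THE\<close>.\<close>

definition kinverse :: "'n::finite kernel \<Rightarrow> 'n kernel" where
  "kinverse A = (SOME L. is_kinverse A L)"

definition toda_Q :: "'n::finite kernel \<Rightarrow> complex ^ 'n ^ 'n" where
  "toda_Q A = kinverse (id_minus A) 1 1"

text \<open>
  The boundary value \<open>r = lo + 1\<close> in the Toda equation. The relations \<open>\<partial>\<^sub>\<eta> K\<^sub>r = \<dots>\<close>,
  \<open>\<partial>\<^sub>\<zeta> K\<^sub>r = \<dots>\<close> for \<open>r > lo\<close> never involve the entry \<open>K\<^sub>l\<^sub>o(1,1)\<close>, whereas \<open>Q\<^sub>l\<^sub>o\<close> does. Hence they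
  cannot imply the Toda equation at \<open>lo + 1\<close>: if \<open>K\<^sub>l\<^sub>o\<close> has the single nonzero entry
  \<open>K\<^sub>l\<^sub>o(1,1) = c\<close>, \<open>c \<noteq> 0, 1\<close>, \<open>n = 1\<close>, and \<open>K\<^sub>r = 0\<close> for \<open>r > lo\<close>, they all hold, but
  \<open>Q\<^sub>l\<^sub>o = 1 / (1 - c)\<close> and \<open>Q\<^sub>r = 1\<close> for \<open>r > lo\<close>. What is needed at this one value of \<open>r\<close> is the
  \<open>\<zeta>\<close>-relation for \<open>r = lo\<close>,
  \<open>\<partial>\<^sub>\<zeta> K\<^sub>l\<^sub>o(u+1,v) = K\<^sub>l\<^sub>o\<^sub>-\<^sub>1(u+1,v+1) - K\<^sub>l\<^sub>o(u+1,v+1)\<close>, at the entries where the shift relation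
  gives a meaning to its right-hand side, that is with \<open>K\<^sub>l\<^sub>o\<^sub>-\<^sub>1(u+1,v+1) = K\<^sub>l\<^sub>o(u,v)\<close>.
\<close>

definition zeta_relation_at_bottom ::
    "(real \<Rightarrow> real \<Rightarrow> 'n::finite kernel) \<Rightarrow> real \<Rightarrow> real \<Rightarrow> bool" where
  "zeta_relation_at_bottom K \<eta> \<zeta> \<longleftrightarrow> (\<forall>u>0. \<forall>v>0.
     ((\<lambda>t. K \<eta> t (u + 1) v) has_vector_derivative
        K \<eta> \<zeta> u v - K \<eta> \<zeta> (u + 1) (v + 1)) (at \<zeta>))"

end

theory Submission
  imports Defs
begin

text \<open>
  Write \<open>A\<^sub>r = I - K\<^sub>r\<close>, \<open>R\<^sub>r\<close> for its inverse, \<open>S\<close> for the backward shift and \<open>U\<^sub>r = R\<^sub>r(2,1) Q\<^sub>r\<^sup>-\<^sup>1\<close>.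
  The shift relation says that \<open>A\<^sub>r\<^sub>+\<^sub>1\<close> is the lower right block of \<open>A\<^sub>r\<close>, so that
  \<open>A\<^sub>r\<^sub>+\<^sub>1 S z = S A\<^sub>r z\<close> whenever \<open>z\<close> vanishes at \<open>1\<close>. Since \<open>\<partial>R\<^sub>r = R\<^sub>r (\<partial>K\<^sub>r) R\<^sub>r\<close>, applying this to
  a difference of first columns gives \<open>\<partial>\<^sub>\<eta>Q\<^sub>r = U\<^sub>r\<^sub>-\<^sub>1 Q\<^sub>r - R\<^sub>r(2,1)\<close>, that is
  \<open>\<partial>\<^sub>\<eta>Q\<^sub>r Q\<^sub>r\<^sup>-\<^sup>1 = U\<^sub>r\<^sub>-\<^sub>1 - U\<^sub>r\<close>, and \<open>\<partial>\<^sub>\<zeta>U\<^sub>r = 1 - Q\<^sub>r\<^sub>+\<^sub>1 Q\<^sub>r\<^sup>-\<^sup>1\<close>. The last identity uses only the rows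
  of \<open>\<partial>\<^sub>\<zeta>K\<^sub>r\<close> with index at least \<open>2\<close>, hence it also holds at the bottom level.
  Analytically, the trace norm enters only through the Hilbert--Schmidt norm that it dominates.
\<close>

section \<open>Square summable sequences and bounded kernels\<close>

lemma L2_set_norm_power2: "(L2_set (\<lambda>u. norm (f u)) U)\<^sup>2 = (\<Sum>u\<in>U. (norm (f u))\<^sup>2)"
  by (simp add: L2_set_def sum_nonneg)

text \<open>All estimates are made on finite sections, where \<open>L2_set\<close> has Minkowski's
  inequality; a bound uniform in the section passes to the infinite sum.\<close>

lemma ell2I:
  fixes f :: "nat \<Rightarrow> complex ^ 'n::finite"
  assumes le: "\<And>U. finite U \<Longrightarrow> U \<subseteq> {0<..} \<Longrightarrow> L2_set (\<lambda>u. norm (f u)) U \<le> M"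
  shows "f \<in> ell2" and "ell2_norm f \<le> M"
proof -
  have M: "0 \<le> M" using le[of "{}"] by simp
  have le2: "(\<Sum>u\<in>U. (norm (f u))\<^sup>2) \<le> M\<^sup>2" if "finite U" "U \<subseteq> {0<..}" for U
    using power_mono[OF le[OF that], of 2] by (simp add: L2_set_norm_power2)
  have s: "(\<lambda>u. (norm (f u))\<^sup>2) summable_on {0<..}"
    by (rule nonneg_bdd_above_summable_on) (auto intro!: bdd_aboveI2[where M="M\<^sup>2"] le2)
  then show "f \<in> ell2" by (simp add: ell2_def)
  have "(\<Sum>\<^sub>\<infinity>u\<in>{0<..}. (norm (f u))\<^sup>2) \<le> M\<^sup>2"
    by (rule infsum_le_finite_sums[OF s le2])
  then show "ell2_norm f \<le> M"
    unfolding ell2_norm_def using M real_le_lsqrt by blast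
qed

lemma ell2_norm_nonneg [simp]: "0 \<le> ell2_norm f"
  by (simp add: ell2_norm_def infsum_nonneg)

lemma ell2_norm_power2:
  "(ell2_norm f)\<^sup>2 = (\<Sum>\<^sub>\<infinity>u\<in>{0<..}. (norm (f u))\<^sup>2)"
  by (simp add: ell2_norm_def infsum_nonneg)

lemma L2_set_le_ell2_norm:
  assumes "f \<in> ell2" "finite U" "U \<subseteq> {0<..}"
  shows "L2_set (\<lambda>u. norm (f u)) U \<le> ell2_norm f"
  unfolding L2_set_def ell2_norm_def
  using assms by (intro real_sqrt_le_mono finite_sum_le_infsum) (auto simp: ell2_def)

lemma norm_le_ell2_norm:
  assumes "f \<in> ell2" "u > 0"
  shows "norm (f u) \<le> ell2_norm f"
  using L2_set_le_ell2_norm[OF assms(1), of "{u}"] assms(2) by simp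

lemma ell2_norm_cong:
  assumes "\<And>u. u > 0 \<Longrightarrow> f u = g u"
  shows "ell2_norm f = ell2_norm g"
proof -
  have "(\<Sum>\<^sub>\<infinity>u\<in>{0<..}. (norm (f u))\<^sup>2) = (\<Sum>\<^sub>\<infinity>u\<in>{0<..}. (norm (g u))\<^sup>2)"
    by (rule infsum_cong) (simp add: assms)
  then show ?thesis
    by (simp add: ell2_norm_def)
qed

lemma ell2_add:
  assumes "f \<in> ell2" "g \<in> ell2"
  shows "(\<lambda>u. f u + g u) \<in> ell2"
    and "ell2_norm (\<lambda>u. f u + g u) \<le> ell2_norm f + ell2_norm g"
proof -
  have "L2_set (\<lambda>u. norm (f u + g u)) U \<le> ell2_norm f + ell2_norm g"
    if U: "finite U" "U \<subseteq> {0<..}" for U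
  proof -
    have "L2_set (\<lambda>u. norm (f u + g u)) U \<le> L2_set (\<lambda>u. norm (f u) + norm (g u)) U"
      by (rule L2_set_mono) (auto simp: norm_triangle_ineq)
    also have "\<dots> \<le> L2_set (\<lambda>u. norm (f u)) U + L2_set (\<lambda>u. norm (g u)) U"
      by (rule L2_set_triangle_ineq)
    finally show ?thesis
      using L2_set_le_ell2_norm[OF assms(1) U] L2_set_le_ell2_norm[OF assms(2) U] by linarith
  qed
  from ell2I[OF this] show "(\<lambda>u. f u + g u) \<in> ell2"
    and "ell2_norm (\<lambda>u. f u + g u) \<le> ell2_norm f + ell2_norm g" by blast+
qed

lemma ell2_scaleR:
  assumes "f \<in> ell2"
  shows "(\<lambda>u. a *\<^sub>R f u) \<in> ell2" and "ell2_norm (\<lambda>u. a *\<^sub>R f u) \<le> \<bar>a\<bar> * ell2_norm f"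
proof -
  have "L2_set (\<lambda>u. norm (a *\<^sub>R f u)) U \<le> \<bar>a\<bar> * ell2_norm f"
    if U: "finite U" "U \<subseteq> {0<..}" for U
    using L2_set_le_ell2_norm[OF assms(1) U]
    by (simp add: mult_left_mono flip: L2_set_right_distrib)
  from ell2I[OF this] show "(\<lambda>u. a *\<^sub>R f u) \<in> ell2"
    and "ell2_norm (\<lambda>u. a *\<^sub>R f u) \<le> \<bar>a\<bar> * ell2_norm f" by blast+
qed

lemma ell2_diff:
  assumes "f \<in> ell2" "g \<in> ell2"
  shows "(\<lambda>u. f u - g u) \<in> ell2"
  using ell2_add(1)[OF assms(1) ell2_scaleR(1)[OF assms(2), of "-1"]] by simp

lemma ell2_Suc:
  assumes "f \<in> ell2"
  shows "(\<lambda>u. f (Suc u)) \<in> ell2"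
proof (rule ell2I)
  fix U :: "nat set" assume U: "finite U" "U \<subseteq> {0<..}"
  have "L2_set (\<lambda>u. norm (f (Suc u))) U = L2_set (\<lambda>u. norm (f u)) (Suc ` U)"
    by (simp add: L2_set_def sum.reindex)
  also have "\<dots> \<le> ell2_norm f"
    using U by (intro L2_set_le_ell2_norm[OF assms]) auto
  finally show "L2_set (\<lambda>u. norm (f (Suc u))) U \<le> ell2_norm f" .
qed

text \<open>A test vector: a kernel applied to it returns block column \<open>b\<close> acting on
  \<open>w\<close>.\<close>

definition single :: "nat \<Rightarrow> complex ^ 'n::finite \<Rightarrow> nat \<Rightarrow> complex ^ 'n" where
  "single b w u = (if u = b then w else 0)"

lemma ell2_single [simp]: "single b w \<in> ell2"
proof (rule ell2I)
  fix U :: "nat set" assume U: "finite U" "U \<subseteq> {0<..}"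
  have "L2_set (\<lambda>u. norm (single b w u)) U \<le> (\<Sum>u\<in>U. norm (single b w u))"
    by (rule L2_set_le_sum) simp
  also have "\<dots> = (\<Sum>u\<in>U. if u = b then norm w else 0)"
    by (rule sum.cong) (auto simp: single_def)
  also have "\<dots> \<le> norm w" using U by simp
  finally show "L2_set (\<lambda>u. norm (single b w u)) U \<le> norm w" .
qed

section \<open>Action of kernels on sequences\<close>

lemma kapply_cong:
  assumes "\<And>v. v > 0 \<Longrightarrow> A u v *v f v = B u v *v g v"
  shows "kapply A f u = kapply B g u"
  unfolding kapply_def by (rule infsum_cong) (simp add: assms)

lemma kapply_single:
  assumes "b > 0"
  shows "kapply A (single b w) u = A u b *v w"
proof -
  have "kapply A (single b w) u = (\<Sum>\<^sub>\<infinity>v\<in>{b}. A u v *v w)"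
    unfolding kapply_def by (rule infsum_cong_neutral) (use assms in \<open>auto simp: single_def\<close>)
  then show ?thesis by simp
qed

lemma bounded_kernel_summable:
  "bounded_kernel A \<Longrightarrow> f \<in> ell2 \<Longrightarrow> u > 0 \<Longrightarrow> (\<lambda>v. A u v *v f v) summable_on {0<..}"
  by (auto simp: bounded_kernel_def)

lemma kapply_ell2: "bounded_kernel A \<Longrightarrow> f \<in> ell2 \<Longrightarrow> kapply A f \<in> ell2"
  by (auto simp: bounded_kernel_def)

lemma bounded_kernelE:
  assumes "bounded_kernel A"
  obtains C where "C \<ge> 0" "\<And>f. f \<in> ell2 \<Longrightarrow> ell2_norm (kapply A f) \<le> C * ell2_norm f"
proof -
  obtain C where C: "\<forall>f\<in>ell2. ell2_norm (kapply A f) \<le> C * ell2_norm f"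
    using assms by (auto simp: bounded_kernel_def)
  have "ell2_norm (kapply A f) \<le> \<bar>C\<bar> * ell2_norm f" if "f \<in> ell2" for f
    using C that by (meson abs_ge_self ell2_norm_nonneg mult_right_mono order_trans)
  then show thesis using that[of "\<bar>C\<bar>"] by auto
qed

lemma kapply_add:
  assumes "bounded_kernel A" "f \<in> ell2" "g \<in> ell2" "u > 0"
  shows "kapply A (\<lambda>v. f v + g v) u = kapply A f u + kapply A g u"
  unfolding kapply_def
  using assms by (simp add: matrix_vector_right_distrib infsum_add bounded_kernel_summable)

lemma matrix_vector_mult_scaleR:
  fixes A :: "complex ^ 'n ^ 'm"
  shows "A *v (a *\<^sub>R x) = a *\<^sub>R (A *v x)" and "(a *\<^sub>R A) *v x = a *\<^sub>R (A *v x)"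
  by (simp_all add: vec_eq_iff matrix_vector_mult_def scaleR_sum_right)

lemma kapply_scaleR:
  shows "kapply A (\<lambda>v. a *\<^sub>R f v) u = a *\<^sub>R kapply A f u"
  unfolding kapply_def by (simp add: matrix_vector_mult_scaleR infsum_scaleR_right)

lemma kapply_diff:
  assumes "bounded_kernel A" "f \<in> ell2" "g \<in> ell2" "u > 0"
  shows "kapply A (\<lambda>v. f v - g v) u = kapply A f u - kapply A g u"
  using kapply_add[OF assms(1,2) ell2_scaleR(1)[OF assms(3), of "-1"] assms(4)]
    kapply_scaleR[of A "-1" g u] by simp

lemma kapply_id_minus:
  assumes "bounded_kernel A" "f \<in> ell2" "u > 0"
  shows "kapply (id_minus A) f u = f u - kapply A f u"
proof -
  have "((\<lambda>v. (if u = v then mat 1 else 0) *v f v) has_sum f u) {0<..}"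
    by (rule has_sum_finite_neutralI[of "{u}"]) (use assms in auto)
  moreover have "((\<lambda>v. - (A u v *v f v)) has_sum (- kapply A f u)) {0<..}"
    unfolding kapply_def has_sum_uminus minus_minus using assms
    by (intro has_sum_infsum) (simp add: bounded_kernel_summable)
  ultimately have "((\<lambda>v. (if u = v then mat 1 else 0) *v f v + - (A u v *v f v))
      has_sum (f u + - kapply A f u)) {0<..}"
    by (rule has_sum_add)
  then show ?thesis
    unfolding kapply_def[of "id_minus A"] id_minus_def
    by (intro infsumI) (simp add: matrix_vector_mult_diff_rdistrib)
qed

text \<open>Row \<open>Suc u\<close> of \<open>A\<close> consists of row \<open>u\<close> of
  \<open>B\<close> and one entry in column 1; the vanishing of \<open>f\<close> at 1 kills the
  latter.\<close>

lemma kapply_shift: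
  assumes "\<And>v. v > 0 \<Longrightarrow> B u v = A (Suc u) (Suc v)" and "f 1 = 0"
  shows "kapply B (\<lambda>v. f (Suc v)) u = kapply A f (Suc u)"
proof -
  have "kapply A f (Suc u) = (\<Sum>\<^sub>\<infinity>v\<in>Suc ` {0<..}. A (Suc u) v *v f v)"
    unfolding kapply_def
  proof (rule infsum_cong_neutral)
    fix v assume "v \<in> {0<..} - Suc ` {0<..}"
    then have "v = 1" by (cases v) (auto simp: image_iff)
    then show "A (Suc u) v *v f v = 0" using assms(2) by simp
  qed auto
  also have "\<dots> = (\<Sum>\<^sub>\<infinity>v\<in>{0<..}. A (Suc u) (Suc v) *v f (Suc v))"
    by (subst infsum_reindex) (auto simp: o_def)
  also have "\<dots> = kapply B (\<lambda>v. f (Suc v)) u"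
    unfolding kapply_def by (rule infsum_cong) (simp add: assms)
  finally show ?thesis by simp
qed

section \<open>Inverse kernels\<close>

lemma kinvertible_kinverse:
  assumes "kinvertible A"
  shows "is_kinverse A (kinverse A)"
  using assms unfolding kinvertible_def kinverse_def by (metis someI_ex)

lemma bounded_kinverse: "kinvertible A \<Longrightarrow> bounded_kernel (kinverse A)"
  using kinvertible_kinverse is_kinverse_def by blast

lemma kinverse_left:
  "kinvertible A \<Longrightarrow> f \<in> ell2 \<Longrightarrow> u > 0 \<Longrightarrow> kapply (kinverse A) (kapply A f) u = f u"
  using kinvertible_kinverse is_kinverse_def by blast

lemma kinverse_right:
  "kinvertible A \<Longrightarrow> f \<in> ell2 \<Longrightarrow> u > 0 \<Longrightarrow> kapply A (kapply (kinverse A) f) u = f u"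
  using kinvertible_kinverse is_kinverse_def by blast

text \<open>Resolvent values are found below by exhibiting a square summable solution
  \<open>f\<close>; agreement at positive indices suffices, because index 0 never enters a
  sum.\<close>

lemma kinverse_eqI:
  assumes "kinvertible A" "f \<in> ell2" "\<And>u. u > 0 \<Longrightarrow> kapply A f u = g u" "u > 0"
  shows "kapply (kinverse A) g u = f u"
proof -
  have "kapply (kinverse A) g u = kapply (kinverse A) (kapply A f) u"
    by (rule kapply_cong) (simp add: assms)
  then show ?thesis using kinverse_left[OF assms(1,2,4)] by simp
qed

section \<open>The trace norm dominates the Hilbert--Schmidt norm\<close>

lemma has_sum_sum:
  fixes f :: "'i \<Rightarrow> 'a \<Rightarrow> 'b::topological_comm_monoid_add"
  assumes "\<And>i. i \<in> I \<Longrightarrow> (f i has_sum s i) A"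
  shows "((\<lambda>x. \<Sum>i\<in>I. f i x) has_sum (\<Sum>i\<in>I. s i)) A"
  using assms by (induction I rule: infinite_finite_induct) (auto intro: has_sum_add)

text \<open>The norm of the nested vector type is the Frobenius norm. The column index is outermost
  because the later estimates go column by column.\<close>

lemma norm_matrix_power2:
  fixes A :: "complex ^ 'n::finite ^ 'm::finite"
  shows "(norm A)\<^sup>2 = (\<Sum>j\<in>UNIV. \<Sum>i\<in>UNIV. (norm (A $ i $ j))\<^sup>2)"
proof -
  have "(norm A)\<^sup>2 = (\<Sum>i\<in>UNIV. \<Sum>j\<in>UNIV. (norm (A $ i $ j))\<^sup>2)"
    by (simp add: norm_vec_def L2_set_def sum_nonneg)
  then show ?thesis by (subst (asm) sum.swap)
qed

lemma norm_matrix_vector_mult_le: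
  fixes A :: "complex ^ 'n::finite ^ 'm::finite"
  shows "norm (A *v x) \<le> norm A * norm x"
proof -
  have "norm ((A *v x) $ i) \<le> norm (A $ i) * norm x" for i
  proof -
    have "norm ((A *v x) $ i) \<le> (\<Sum>j\<in>UNIV. norm (A $ i $ j) * norm (x $ j))"
      unfolding matrix_vector_mult_def by (simp add: sum_norm_le norm_mult)
    also have "\<dots> \<le> norm (A $ i) * norm x"
      using L2_set_mult_ineq[of "\<lambda>j. norm (A $ i $ j)" "\<lambda>j. norm (x $ j)" UNIV]
      by (simp add: norm_vec_def)
    finally show ?thesis .
  qed
  then have "norm (A *v x) \<le> L2_set (\<lambda>i. norm (A $ i) * norm x) UNIV"
    unfolding norm_vec_def[of "A *v x"] by (intro L2_set_mono) auto
  then show ?thesis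
    by (simp add: norm_vec_def[of A] flip: L2_set_left_distrib)
qed

lemma matrix_vector_mult_axis: "(A *v axis j a) $ i = A $ i $ j * a" for A :: "complex ^ 'n::finite ^ 'm"
  by (simp add: matrix_vector_mult_def axis_def if_distrib[of "\<lambda>x. _ * x"] cong: if_cong)

lemma norm_vector_power2: "(norm (x :: complex ^ 'n::finite))\<^sup>2 = (\<Sum>i\<in>UNIV. (norm (x $ i))\<^sup>2)"
  by (simp add: norm_vec_def L2_set_def sum_nonneg)

lemma norm_matrix_power2_columns:
  fixes A :: "complex ^ 'n::finite ^ 'm::finite"
  shows "(norm A)\<^sup>2 = (\<Sum>j\<in>UNIV. (norm (A *v axis j 1))\<^sup>2)"
  by (simp add: norm_matrix_power2 norm_vector_power2 matrix_vector_mult_axis)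

section \<open>Entries of positive kernels\<close>

lemma ell2_inner_single:
  assumes "u > 0" "v > 0"
  shows "ell2_inner (\<lambda>p. single u (axis i a) p + single v (axis j b) p) g
    = cnj a * g u $ i + cnj b * g v $ j"
proof -
  have *: "((\<lambda>p. \<Sum>k\<in>UNIV. cnj (single u (axis i a) p $ k) * g p $ k) has_sum cnj a * g u $ i) {0<..}"
    if "u > 0" for u i a
    by (rule has_sum_finite_neutralI[of "{u}"])
      (use that in \<open>auto simp: single_def axis_def if_distrib[of cnj] if_distrib[of "\<lambda>x. x * _"] cong: if_cong\<close>)
  have "((\<lambda>p. (\<Sum>k\<in>UNIV. cnj (single u (axis i a) p $ k) * g p $ k)
      + (\<Sum>k\<in>UNIV. cnj (single v (axis j b) p $ k) * g p $ k)) has_sum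
      (cnj a * g u $ i + cnj b * g v $ j)) {0<..}"
    by (intro has_sum_add * assms)
  then show ?thesis
    unfolding ell2_inner_def by (intro infsumI) (simp add: ring_distribs sum.distrib)
qed

text \<open>This is the quadratic form of \<open>B\<close> on the vector with \<open>a\<close> in
  slot \<open>i\<close> at \<open>u\<close> plus \<open>b\<close> in slot \<open>j\<close> at
  \<open>v\<close>. Being a sum, the vector also makes sense when the two places coincide.\<close>

lemma positive_kernel_form:
  assumes B: "positive_kernel B" and "u > 0" "v > 0"
  shows "cnj a * a * B u u $ i $ i + cnj a * b * B u v $ i $ j
    + cnj b * a * B v u $ j $ i + cnj b * b * B v v $ j $ j \<in> \<real>\<^sub>\<ge>\<^sub>0"
proof -
  let ?f = "\<lambda>p. single u (axis i a) p + single v (axis j b) p"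
  have bd: "bounded_kernel B" using B by (simp add: positive_kernel_def)
  have "ell2_inner ?f (kapply B ?f) \<in> \<real>\<^sub>\<ge>\<^sub>0"
    using B ell2_add(1)[OF ell2_single ell2_single] unfolding positive_kernel_def by blast
  moreover have "kapply B ?f p = B p u *v axis i a + B p v *v axis j b" if "p > 0" for p
    using kapply_add[OF bd ell2_single ell2_single that] assms by (simp add: kapply_single)
  ultimately show ?thesis
    using assms by (simp add: ell2_inner_single matrix_vector_mult_axis algebra_simps)
qed

text \<open>A nonnegative form on pairs of complex numbers is Hermitian by polarization, and
  Cauchy-Schwarz for the form makes its determinant nonnegative.\<close>

lemma positive_form_2x2:
  fixes p q z z' :: complex
  assumes nn: "\<And>a b. cnj a * a * p + cnj a * b * z + cnj b * a * z' + cnj b * b * q \<in> \<real>\<^sub>\<ge>\<^sub>0"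
  shows "z' = cnj z" and "0 \<le> Re p" and "(norm z)\<^sup>2 \<le> Re p * Re q"
proof -
  have p: "Re p \<ge> 0" "Im p = 0" using nn[of 1 0] by (auto simp: complex_nonneg_Reals_iff)
  have q: "Re q \<ge> 0" "Im q = 0" using nn[of 0 1] by (auto simp: complex_nonneg_Reals_iff)
  \<comment> \<open>Reality of the form at \<open>(1, 1)\<close> makes the imaginary parts opposite;
    at \<open>(1, \<i>)\<close> it makes the real parts equal.\<close>
  show z': "z' = cnj z"
    using nn[of 1 1] nn[of 1 \<i>] p q by (auto simp: complex_nonneg_Reals_iff complex_eq_iff)
  show "0 \<le> Re p" by fact
  define m where "m = (norm z)\<^sup>2"
  have zz: "z * cnj z = of_real m" unfolding m_def by (rule complex_norm_square[symmetric])
  have pq: "p = of_real (Re p)" "q = of_real (Re q)" using p q by (auto simp: complex_eq_iff)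
  \<comment> \<open>Taking \<open>b\<close> to be a real multiple of \<open>cnj z\<close> removes
    the phase of \<open>z\<close> and leaves a real quadratic form in \<open>s\<close> and
    \<open>t\<close>.\<close>
  have key: "0 \<le> s\<^sup>2 * Re p - 2 * s * t * m + t\<^sup>2 * m * Re q" for s t :: real
  proof -
    have "cnj (of_real s) * of_real s * p + cnj (of_real s) * (- of_real t * cnj z) * z
       + cnj (- of_real t * cnj z) * of_real s * z'
       + cnj (- of_real t * cnj z) * (- of_real t * cnj z) * q
       = of_real s * of_real s * of_real (Re p) - of_real s * of_real t * (z * cnj z)
         - of_real s * of_real t * (z * cnj z) + of_real t * of_real t * (z * cnj z) * of_real (Re q)"
      unfolding z' by (subst (1) pq(1), subst (1) pq(2)) (simp add: algebra_simps)
    also have "\<dots> = of_real (s\<^sup>2 * Re p - 2 * s * t * m + t\<^sup>2 * m * Re q)"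
      unfolding zz by (simp add: power2_eq_square)
    finally have "complex_of_real (s\<^sup>2 * Re p - 2 * s * t * m + t\<^sup>2 * m * Re q) \<in> \<real>\<^sub>\<ge>\<^sub>0"
      using nn[of "of_real s" "- of_real t * cnj z"] by simp
    then show ?thesis by (simp add: complex_nonneg_Reals_iff)
  qed
  show "(norm z)\<^sup>2 \<le> Re p * Re q"
  proof (cases "Re q = 0")
    case True
    have "m = 0"
    proof (rule ccontr)
      assume "m \<noteq> 0"
      \<comment> \<open>With \<open>Re q = 0\<close> the form is linear in \<open>t\<close>; this
        \<open>t\<close> gives it the value \<open>- Re p - 2\<close>, which is negative.\<close>
      then show False using key[of 1 "(Re p + 1) / m"] True p(1) by (simp add: m_def)
    qed
    with True show ?thesis by (simp add: m_def)
  next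
    case False
    with q have "Re q > 0" by simp
    \<comment> \<open>The values \<open>s = Re q\<close> and \<open>t = 1\<close> make the form
      factor in this way.\<close>
    have "0 \<le> Re q * (Re p * Re q - m)"
      using key[of "Re q" 1] by (simp add: power2_eq_square algebra_simps)
    with \<open>Re q > 0\<close> have "0 \<le> Re p * Re q - m"
      by (simp add: zero_le_mult_iff)
    then show ?thesis by (simp add: m_def)
  qed
qed

text \<open>The \<open>2 \<times> 2\<close> case bounds every entry by two diagonal entries, which
  is how the trace comes to control the whole kernel.\<close>

lemma positive_kernel_entries:
  assumes "positive_kernel B" "u > 0" "v > 0"
  shows "B v u $ j $ i = cnj (B u v $ i $ j)" and "0 \<le> Re (B u u $ i $ i)"
    and "(norm (B u v $ i $ j))\<^sup>2 \<le> Re (B u u $ i $ i) * Re (B v v $ j $ j)"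
  using positive_form_2x2[of "B u u $ i $ i" "B u v $ i $ j" "B v u $ j $ i" "B v v $ j $ j",
      OF positive_kernel_form[OF assms]] by blast+

text \<open>A diagonal entry of the adjoint of \<open>A\<close> times \<open>A\<close> is the
  squared norm of a column of \<open>A\<close>. Convergence is checked directly, as
  \<open>kadjoint\<close> is only an entrywise formula.\<close>

lemma kadjoint_column_norm:
  assumes A: "bounded_kernel A" and v: "v > 0"
  shows "kapply (kadjoint A) (kapply A (single v (axis j 1))) v $ j
    = of_real ((ell2_norm (kapply A (single v (axis j 1))))\<^sup>2)"
proof -
  define g where "g = kapply A (single v (axis j 1))"
  have g: "g u = A u v *v axis j 1" for u by (simp add: g_def kapply_single v)
  have g2: "(\<lambda>u. (norm (A u v *v axis k 1))\<^sup>2) summable_on {0<..}" for k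
    using kapply_ell2[OF A ell2_single, of v "axis k 1"] v by (simp add: ell2_def kapply_single)
  then have A2: "(\<lambda>u. (norm (A u v))\<^sup>2) summable_on {0<..}"
    unfolding norm_matrix_power2_columns
    by (rule has_sum_imp_summable[OF has_sum_sum[OF has_sum_infsum]])
  \<comment> \<open>Column \<open>v\<close> of \<open>A\<close> and \<open>g\<close> are both square
    summable, so the products are dominated by the sum of the squares.\<close>
  have s: "(\<lambda>u. kadjoint A v u *v g u) summable_on {0<..}"
  proof (rule abs_summable_summable, rule summable_on_comparison_test)
    show "(\<lambda>u. (norm (A u v))\<^sup>2 + (norm (g u))\<^sup>2) summable_on {0<..}"
      using A2 g2 by (simp add: g summable_on_add)
    fix u
    have "norm (kadjoint A v u) = norm (A u v)"
    proof (rule power2_eq_imp_eq)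
      show "(norm (kadjoint A v u))\<^sup>2 = (norm (A u v))\<^sup>2"
        unfolding norm_matrix_power2 kadjoint_def by (simp, rule sum.swap)
    qed auto
    then have "norm (kadjoint A v u *v g u) \<le> norm (A u v) * norm (g u)"
      by (metis norm_matrix_vector_mult_le)
    also have "\<dots> \<le> (norm (A u v))\<^sup>2 + (norm (g u))\<^sup>2"
      using sum_squares_bound[of "norm (A u v)" "norm (g u)"]
        mult_nonneg_nonneg[OF norm_ge_zero norm_ge_zero, of "A u v" "g u"] by linarith
    finally show "norm (kadjoint A v u *v g u) \<le> (norm (A u v))\<^sup>2 + (norm (g u))\<^sup>2" .
  qed auto
  have entry: "(kadjoint A v u *v g u) $ j = of_real ((norm (g u))\<^sup>2)" for u
  proof -
    have "(kadjoint A v u *v g u) $ j = (\<Sum>k\<in>UNIV. g u $ k * cnj (g u $ k))"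
      by (simp add: g matrix_vector_mult_axis kadjoint_def matrix_vector_mult_def[of "\<chi> i j. _ i j"]
          mult.commute)
    then show ?thesis
      unfolding norm_vector_power2 of_real_sum complex_norm_square .
  qed
  have "((\<lambda>u. (kadjoint A v u *v g u) $ j) has_sum kapply (kadjoint A) g v $ j) {0<..}"
    unfolding kapply_def by (rule has_sum_bounded_linear[OF bounded_linear_vec_nth has_sum_infsum[OF s]])
  moreover have "((\<lambda>u. complex_of_real ((norm (g u))\<^sup>2)) has_sum of_real ((ell2_norm g)\<^sup>2)) {0<..}"
    unfolding ell2_norm_power2 using g2
    by (intro has_sum_of_real has_sum_infsum) (simp add: g)
  ultimately have "kapply (kadjoint A) g v $ j = of_real ((ell2_norm g)\<^sup>2)"
    unfolding entry by (rule has_sum_unique)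
  then show ?thesis by (simp add: g_def)
qed

lemma positive_kernel_kadjoint:
  assumes "positive_kernel B" "u > 0" "v > 0"
  shows "kadjoint B u v = B u v"
  unfolding kadjoint_def vec_eq_iff
  using positive_kernel_entries(1)[OF assms] by simp

text \<open>Both squared norms are the same diagonal entry: \<open>B\<close> is self-adjoint at
  positive indices, and its square agrees with the adjoint of \<open>A\<close> times
  \<open>A\<close>.\<close>

lemma kabs_column_norm:
  assumes A: "bounded_kernel A" and B: "is_kabs A B" and v: "v > 0"
  shows "ell2_norm (kapply A (single v (axis j 1))) = ell2_norm (kapply B (single v (axis j 1)))"
    (is "ell2_norm (kapply A ?s) = _")
proof -
  have pos: "positive_kernel B" and bd: "bounded_kernel B"
    using B by (auto simp: is_kabs_def positive_kernel_def)
  have "kapply (kadjoint A) (kapply A ?s) v = kapply B (kapply B ?s) v"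
    using B v by (simp add: is_kabs_def)
  also have "\<dots> = kapply (kadjoint B) (kapply B ?s) v"
    by (rule kapply_cong) (simp add: positive_kernel_kadjoint pos v)
  finally show ?thesis
    using kadjoint_column_norm[OF A v, of j] kadjoint_column_norm[OF bd v, of j]
    by (simp flip: of_real_power)
qed

text \<open>By the entry bound a block has squared norm at most the product of the traces of two
  diagonal blocks, and the double sum of these products factors.\<close>

lemma positive_kernel_hilbert_schmidt:
  assumes pos: "positive_kernel B"
    and tr: "((\<lambda>u. trace (B u u)) has_sum complex_of_real t) {0<..}"
    and U: "finite U" "U \<subseteq> {0<..}" and V: "finite V" "V \<subseteq> {0<..}"
  shows "(\<Sum>u\<in>U. \<Sum>v\<in>V. (norm (B u v))\<^sup>2) \<le> t\<^sup>2" and "0 \<le> t"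
proof -
  define d where "d u = Re (trace (B u u))" for u
  have tr': "(d has_sum t) {0<..}"
    using has_sum_bounded_linear[OF bounded_linear_Re tr] by (simp add: d_def[abs_def])
  have d0: "0 \<le> d u" if "u > 0" for u
    unfolding d_def trace_def
    using positive_kernel_entries(2)[OF pos that that] by (simp add: sum_nonneg)
  have le: "sum d W \<le> t" if "finite W" "W \<subseteq> {0<..}" for W
    using that d0 by (intro finite_sum_le_has_sum[OF tr']) auto
  show t: "0 \<le> t" using le[of "{}"] by simp
  have "(\<Sum>u\<in>U. \<Sum>v\<in>V. (norm (B u v))\<^sup>2) \<le> (\<Sum>u\<in>U. \<Sum>v\<in>V. d u * d v)"
  proof (intro sum_mono)
    fix u v assume "u \<in> U" "v \<in> V"
    then have "u > 0" "v > 0" using U V by auto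
    then have "(norm (B u v))\<^sup>2 \<le> (\<Sum>j\<in>UNIV. \<Sum>i\<in>UNIV. Re (B u u $ i $ i) * Re (B v v $ j $ j))"
      unfolding norm_matrix_power2 by (intro sum_mono positive_kernel_entries(3)[OF pos])
    also have "\<dots> = d u * d v"
      unfolding d_def trace_def Re_sum by (subst sum.swap) (simp add: sum_product)
    finally show "(norm (B u v))\<^sup>2 \<le> d u * d v" .
  qed
  also have "\<dots> = sum d U * sum d V" by (simp add: sum_product)
  also have "\<dots> \<le> t * t"
    using le U V d0 t by (intro mult_mono sum_nonneg) auto
  finally show "(\<Sum>u\<in>U. \<Sum>v\<in>V. (norm (B u v))\<^sup>2) \<le> t\<^sup>2" by (simp add: power2_eq_square)
qed

text \<open>\<open>A\<close> and its absolute value have equal column norms, so the bound for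
  positive kernels carries over.\<close>

lemma has_trace_norm_hilbert_schmidt:
  assumes "has_trace_norm A t"
    and U: "finite U" "U \<subseteq> {0<..}" and V: "finite V" "V \<subseteq> {0<..}"
  shows "(\<Sum>u\<in>U. \<Sum>v\<in>V. (norm (A u v))\<^sup>2) \<le> t\<^sup>2" and "0 \<le> t"
proof -
  obtain B where A: "bounded_kernel A" and B: "is_kabs A B"
    and tr: "((\<lambda>u. trace (B u u)) has_sum complex_of_real t) {0<..}"
    using assms(1) by (auto simp: has_trace_norm_def)
  have pos: "positive_kernel B" and bd: "bounded_kernel B"
    using B by (auto simp: is_kabs_def positive_kernel_def)
  note hs = positive_kernel_hilbert_schmidt[OF pos tr]
  show "0 \<le> t" by (rule hs(2)) (use U in auto)
  let ?s = "\<lambda>v j. single v (axis j 1) :: nat \<Rightarrow> complex ^ 'a"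
  have sB: "(\<lambda>u. (norm (B u v *v axis j 1))\<^sup>2) summable_on {0<..}" if "v > 0" for v j
    using kapply_ell2[OF bd ell2_single, of v "axis j 1"] that by (simp add: ell2_def kapply_single)
  have "(\<Sum>u\<in>U. \<Sum>v\<in>V. (norm (A u v))\<^sup>2) = (\<Sum>v\<in>V. \<Sum>j\<in>UNIV. \<Sum>u\<in>U. (norm (kapply A (?s v j) u))\<^sup>2)"
    unfolding norm_matrix_power2_columns
    using V by (subst sum.swap, intro sum.cong refl, subst sum.swap) (auto simp: kapply_single)
  \<comment> \<open>The rows outside \<open>U\<close> are added, since the norms of \<open>A\<close>
    and \<open>B\<close> are compared on complete columns only.\<close>
  also have "\<dots> \<le> (\<Sum>v\<in>V. \<Sum>j\<in>UNIV. (ell2_norm (kapply A (?s v j)))\<^sup>2)"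
    using power_mono[OF L2_set_le_ell2_norm[OF kapply_ell2[OF A] U], of "?s _ _" 2]
    by (intro sum_mono) (simp add: L2_set_norm_power2)
  also have "\<dots> = (\<Sum>v\<in>V. \<Sum>j\<in>UNIV. (ell2_norm (kapply B (?s v j)))\<^sup>2)"
    using V by (intro sum.cong refl) (auto simp: kabs_column_norm[OF A B])
  also have "\<dots> = (\<Sum>v\<in>V. \<Sum>j\<in>UNIV. \<Sum>\<^sub>\<infinity>u\<in>{0<..}. (norm (B u v *v axis j 1))\<^sup>2)"
    using V by (intro sum.cong refl) (auto simp: ell2_norm_power2 kapply_single)
  also have "\<dots> \<le> t\<^sup>2"
  proof (rule has_sum_le_finite_sums)
    show "((\<lambda>u. \<Sum>v\<in>V. (norm (B u v))\<^sup>2) has_sum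
        (\<Sum>v\<in>V. \<Sum>j\<in>UNIV. \<Sum>\<^sub>\<infinity>u\<in>{0<..}. (norm (B u v *v axis j 1))\<^sup>2)) {0<..}"
      unfolding norm_matrix_power2_columns using V by (intro has_sum_sum has_sum_infsum sB) auto
    show "(\<Sum>u\<in>F. \<Sum>v\<in>V. (norm (B u v))\<^sup>2) \<le> t\<^sup>2" if "finite F" "F \<subseteq> {0<..}" for F
      by (rule hs(1)[OF that V])
  qed
  finally show "(\<Sum>u\<in>U. \<Sum>v\<in>V. (norm (A u v))\<^sup>2) \<le> t\<^sup>2" .
qed

lemma has_trace_norm_imp_bounded: "has_trace_norm A t \<Longrightarrow> bounded_kernel A"
  by (simp add: has_trace_norm_def)

lemma trace_class_imp_bounded: "trace_class A \<Longrightarrow> bounded_kernel A"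
  by (auto simp: trace_class_def has_trace_norm_def)

text \<open>Cauchy-Schwarz on finite sections bounds the operator norm by the Hilbert-Schmidt norm,
  hence by the trace norm.\<close>

lemma has_trace_norm_ell2_norm:
  assumes A: "has_trace_norm A t" and f: "f \<in> ell2"
  shows "ell2_norm (kapply A f) \<le> t * ell2_norm f"
proof (rule ell2I(2))
  fix U :: "nat set" assume U: "finite U" "U \<subseteq> {0<..}"
  have t: "0 \<le> t" using has_trace_norm_hilbert_schmidt(2)[OF A, of "{}" "{}"] by simp
  have fin: "L2_set (\<lambda>u. norm (\<Sum>v\<in>V. A u v *v f v)) U \<le> t * ell2_norm f"
    if V: "finite V" "V \<subseteq> {0<..}" for V
  proof -
    have "L2_set (\<lambda>u. norm (\<Sum>v\<in>V. A u v *v f v)) U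
        \<le> L2_set (\<lambda>u. L2_set (\<lambda>v. norm (A u v)) V * ell2_norm f) U"
    proof (rule L2_set_mono)
      fix u
      have "norm (\<Sum>v\<in>V. A u v *v f v) \<le> (\<Sum>v\<in>V. norm (A u v) * norm (f v))"
        by (rule sum_norm_le) (rule norm_matrix_vector_mult_le)
      also have "\<dots> \<le> L2_set (\<lambda>v. norm (A u v)) V * L2_set (\<lambda>v. norm (f v)) V"
        using L2_set_mult_ineq[of "\<lambda>v. norm (A u v)" "\<lambda>v. norm (f v)" V] by simp
      also have "\<dots> \<le> L2_set (\<lambda>v. norm (A u v)) V * ell2_norm f"
        by (rule mult_left_mono[OF L2_set_le_ell2_norm[OF f V]]) simp
      finally show "norm (\<Sum>v\<in>V. A u v *v f v) \<le> L2_set (\<lambda>v. norm (A u v)) V * ell2_norm f" .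
    qed simp
    also have "\<dots> = L2_set (\<lambda>u. L2_set (\<lambda>v. norm (A u v)) V) U * ell2_norm f"
      by (simp add: L2_set_left_distrib)
    also have "L2_set (\<lambda>u. L2_set (\<lambda>v. norm (A u v)) V) U \<le> t"
      unfolding L2_set_def
      using has_trace_norm_hilbert_schmidt(1)[OF A U V] t
      by (intro real_le_lsqrt) (auto simp: sum_nonneg)
    finally show ?thesis by (simp add: mult_right_mono)
  qed
  \<comment> \<open>The rows \<open>U\<close> stay fixed while the column set \<open>V\<close>
    exhausts the positive integers, so only a finite sum of limits is taken.\<close>
  have "((\<lambda>V. L2_set (\<lambda>u. norm (\<Sum>v\<in>V. A u v *v f v)) U) \<longlongrightarrow> L2_set (\<lambda>u. norm (kapply A f u)) U)
      (finite_subsets_at_top {0<..})"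
    unfolding L2_set_def kapply_def
    using U f bounded_kernel_summable[OF has_trace_norm_imp_bounded[OF A]]
    by (intro tendsto_intros infsum_tendsto) auto
  then show "L2_set (\<lambda>u. norm (kapply A f u)) U \<le> t * ell2_norm f"
    by (rule tendsto_upperbound) (auto intro!: eventually_finite_subsets_at_top_weakI fin)
qed

section \<open>Differentiating inverses\<close>

text \<open>Puts derivatives into the difference quotient form in which
  \<open>has_trace_norm_derivative\<close> is stated.\<close>

lemma has_vector_derivative_at_iff_tendsto:
  "(f has_vector_derivative f') (at x) \<longleftrightarrow> ((\<lambda>y. (f y - f x) /\<^sub>R (y - x)) \<longlongrightarrow> f') (at x)"
proof -
  have "(f has_vector_derivative f') (at x) \<longleftrightarrow>
      ((\<lambda>y. norm (f y - f x - (y - x) *\<^sub>R f') / norm (y - x)) \<longlongrightarrow> 0) (at x)"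
    unfolding has_vector_derivative_def has_derivative_at_within
    by (subst tendsto_norm_zero_iff[symmetric])
      (auto simp: bounded_linear_scaleR_left divide_inverse mult.commute)
  also have "\<dots> \<longleftrightarrow> ((\<lambda>y. norm ((f y - f x) /\<^sub>R (y - x) - f')) \<longlongrightarrow> 0) (at x)"
  proof (rule tendsto_cong)
    have "norm (f y - f x - (y - x) *\<^sub>R f') / norm (y - x) = norm ((f y - f x) /\<^sub>R (y - x) - f')"
      if "y \<noteq> x" for y
    proof -
      have "(f y - f x) /\<^sub>R (y - x) - f' = (f y - f x - (y - x) *\<^sub>R f') /\<^sub>R (y - x)"
        using that by (simp add: scaleR_diff_right)
      then show ?thesis by (simp add: divide_inverse mult.commute)
    qed
    then show "\<forall>\<^sub>F y in at x. norm (f y - f x - (y - x) *\<^sub>R f') / norm (y - x)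
        = norm ((f y - f x) /\<^sub>R (y - x) - f')"
      by (auto simp: eventually_at_filter)
  qed
  also have "\<dots> \<longleftrightarrow> ((\<lambda>y. (f y - f x) /\<^sub>R (y - x)) \<longlongrightarrow> f') (at x)"
    by (simp add: tendsto_norm_zero_iff flip: LIM_zero_iff[of _ f'])
  finally show ?thesis .
qed

text \<open>One block is bounded by the Hilbert-Schmidt norm. With uniqueness of derivatives this
  identifies \<open>D\<close> with the right-hand sides of the given relations.\<close>

lemma has_trace_norm_derivative_entry:
  assumes "has_trace_norm_derivative F D x" "u > 0" "v > 0"
  shows "((\<lambda>y. F y u v) has_vector_derivative D u v) (at x)"
  unfolding has_vector_derivative_at_iff_tendsto
proof (rule tendstoI)
  fix e :: real assume "e > 0"
  then have "\<forall>\<^sub>F y in at x. \<exists>t<e. has_trace_norm (\<lambda>u v. (F y u v - F x u v) /\<^sub>R (y - x) - D u v) t"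
    using assms(1) by (simp add: has_trace_norm_derivative_def)
  then show "\<forall>\<^sub>F y in at x. dist ((F y u v - F x u v) /\<^sub>R (y - x)) (D u v) < e"
  proof (rule eventually_mono)
    fix y assume "\<exists>t<e. has_trace_norm (\<lambda>u v. (F y u v - F x u v) /\<^sub>R (y - x) - D u v) t"
    then obtain t where t: "t < e" "has_trace_norm (\<lambda>u v. (F y u v - F x u v) /\<^sub>R (y - x) - D u v) t"
      by blast
    have "norm ((F y u v - F x u v) /\<^sub>R (y - x) - D u v) \<le> t"
      using has_trace_norm_hilbert_schmidt[OF t(2), of "{u}" "{v}"] assms(2,3)
      by (auto intro: power2_le_imp_le)
    then show "dist ((F y u v - F x u v) /\<^sub>R (y - x)) (D u v) < e"
      using t(1) by (simp add: dist_norm)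
  qed
qed

text \<open>Used with \<open>A\<close> as \<open>F y\<close>, \<open>B\<close> as \<open>F x\<close>
  and \<open>a\<close> as \<open>y - x\<close>, where \<open>E\<close> is the error of the
  difference quotient.\<close>

lemma kapply_lincomb:
  assumes "bounded_kernel B" "bounded_kernel E" "bounded_kernel D" "f \<in> ell2" "u > 0"
    and "\<And>v. A u v = B u v + a *\<^sub>R (E u v + D u v)"
  shows "kapply A f u = kapply B f u + a *\<^sub>R (kapply E f u + kapply D f u)"
proof -
  have s: "((\<lambda>v. M u v *v f v) has_sum kapply M f u) {0<..}" if "bounded_kernel M" for M :: "'a kernel"
    unfolding kapply_def using assms that by (intro has_sum_infsum bounded_kernel_summable)
  have "((\<lambda>v. B u v *v f v + a *\<^sub>R (E u v *v f v + D u v *v f v)) has_sum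
      kapply B f u + a *\<^sub>R (kapply E f u + kapply D f u)) {0<..}"
    by (intro has_sum_add has_sum_bounded_linear[OF bounded_linear_scaleR_right] s assms)
  then show ?thesis
    unfolding kapply_def[of A]
    by (intro infsumI) (simp add: assms(6) matrix_vector_mult_add_rdistrib matrix_vector_mult_scaleR)
qed

text \<open>The identity behind this is
  \<open>c\<^sub>y - c\<^sub>x = (I - F\<^sub>x)\<^sup>-\<^sup>1 (F\<^sub>y - F\<^sub>x) c\<^sub>y\<close> for \<open>c\<^sub>y = (I - F\<^sub>y)\<^sup>-\<^sup>1 g\<close>.\<close>

lemma kinverse_has_vector_derivative:
  fixes F :: "real \<Rightarrow> 'n::finite kernel"
  assumes D: "has_trace_norm_derivative F D x"
    and bd: "\<forall>\<^sub>F y in at x. bounded_kernel (F y) \<and> kinvertible (id_minus (F y))"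
    and bdx: "bounded_kernel (F x)" "kinvertible (id_minus (F x))"
    and g: "g \<in> ell2" and a: "a > 0"
  defines "c \<equiv> \<lambda>y. kapply (kinverse (id_minus (F y))) g"
  shows "((\<lambda>y. c y a) has_vector_derivative kapply (kinverse (id_minus (F x))) (kapply D (c x)) a) (at x)"
proof -
  define L where "L = kinverse (id_minus (F x))"
  have bdL: "bounded_kernel L" unfolding L_def by (rule bounded_kinverse[OF bdx(2)])
  have bdD: "bounded_kernel D"
    using D by (simp add: has_trace_norm_derivative_def trace_class_imp_bounded)
  obtain C where C: "C \<ge> 0" "\<And>f. f \<in> ell2 \<Longrightarrow> ell2_norm (kapply L f) \<le> C * ell2_norm f"
    using bounded_kernelE[OF bdL] by blast
  obtain C' where C': "C' \<ge> 0" "\<And>f. f \<in> ell2 \<Longrightarrow> ell2_norm (kapply D f) \<le> C' * ell2_norm f"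
    using bounded_kernelE[OF bdD] by blast
  \<comment> \<open>The error of the difference quotient; its trace norm, and so its operator norm,
    tends to 0.\<close>
  define E where "E y = (\<lambda>u v. (F y u v - F x u v) /\<^sub>R (y - x) - D u v)" for y
  have cx: "c x \<in> ell2"
    unfolding c_def by (rule kapply_ell2[OF bounded_kinverse[OF bdx(2)] g])
  have evE: "\<forall>\<^sub>F y in at x. \<exists>t<\<epsilon>. has_trace_norm (E y) t" if "\<epsilon> > 0" for \<epsilon>
    using D that by (simp add: has_trace_norm_derivative_def E_def)
  \<comment> \<open>Will bound the norm of \<open>c y\<close> near \<open>x\<close>; the factor 2
    comes from absorbing half of that norm.\<close>
  define N where "N = 2 * ell2_norm (c x)"
  have N: "N \<ge> 0" by (simp add: N_def)
  \<comment> \<open>Bounds the operator norm of \<open>L\<close> composed with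
    \<open>E y + D\<close> once \<open>E y\<close> has trace norm at most 1.\<close>
  define M where "M = C * (1 + C')"
  have M: "M \<ge> 0" using C C' by (simp add: M_def)
  have key: "norm ((c y a - c x a) /\<^sub>R (y - x) - kapply L (kapply D (c x)) a)
      \<le> C * \<epsilon> * N + C * C' * M * N * \<bar>y - x\<bar>"
    if y: "y \<noteq> x" "bounded_kernel (F y)" "kinvertible (id_minus (F y))"
      and t: "t < \<epsilon>" "has_trace_norm (E y) t" and \<epsilon>: "\<epsilon> \<le> 1" and small: "\<bar>y - x\<bar> * M \<le> 1/2" for y t \<epsilon>
  proof -
    have t0: "0 \<le> t" using has_trace_norm_hilbert_schmidt(2)[OF t(2), of "{}" "{}"] by simp
    have bdE: "bounded_kernel (E y)" by (rule has_trace_norm_imp_bounded[OF t(2)])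
    have cy: "c y \<in> ell2"
      unfolding c_def by (rule kapply_ell2[OF bounded_kinverse[OF y(3)] g])
    have Ele: "ell2_norm (kapply (E y) f) \<le> t * ell2_norm f" if "f \<in> ell2" for f
      by (rule has_trace_norm_ell2_norm[OF t(2) that])
    note mem = cx cy kapply_ell2[OF bdE cy] kapply_ell2[OF bdD cy] kapply_ell2[OF bdD cx]
      ell2_diff[OF cy cx]
    define h where "h = (\<lambda>u. kapply (E y) (c y) u + kapply D (c y) u)"
    have h: "h \<in> ell2" unfolding h_def by (intro ell2_add(1) mem)
    have diff: "c y u - c x u = (y - x) *\<^sub>R kapply L h u" if "u > 0" for u
    proof -
      have "kapply L (\<lambda>v. (y - x) *\<^sub>R h v) u = c y u - c x u"
        unfolding L_def
      proof (rule kinverse_eqI[OF bdx(2) ell2_diff[OF cy cx] _ that])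
        fix v :: nat assume v: "v > 0"
        have gx: "c x v - kapply (F x) (c x) v = g v"
          using kinverse_right[OF bdx(2) g v] kapply_id_minus[OF bdx(1) cx v] by (simp add: c_def)
        have "c y v - kapply (F y) (c y) v = g v"
          using kinverse_right[OF y(3) g v] kapply_id_minus[OF y(2) cy v] by (simp add: c_def)
        moreover have "kapply (F y) (c y) v = kapply (F x) (c y) v + (y - x) *\<^sub>R h v"
          unfolding h_def by (rule kapply_lincomb[OF bdx(1) bdE bdD cy v]) (use y(1) in \<open>simp add: E_def\<close>)
        ultimately have gy: "c y v - (kapply (F x) (c y) v + (y - x) *\<^sub>R h v) = g v"
          by simp
        have "kapply (id_minus (F x)) (\<lambda>u. c y u - c x u) v
            = (c y v - c x v) - (kapply (F x) (c y) v - kapply (F x) (c x) v)"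
          by (simp add: kapply_id_minus[OF bdx(1) ell2_diff[OF cy cx] v] kapply_diff[OF bdx(1) cy cx v])
        also have "\<dots> = (c y v - (kapply (F x) (c y) v + (y - x) *\<^sub>R h v))
            - (c x v - kapply (F x) (c x) v) + (y - x) *\<^sub>R h v"
          by simp
        also have "\<dots> = (y - x) *\<^sub>R h v"
          unfolding gx gy by simp
        finally show "kapply (id_minus (F x)) (\<lambda>u. c y u - c x u) v = (y - x) *\<^sub>R h v" .
      qed
      then show ?thesis by (simp add: kapply_scaleR)
    qed
    have "ell2_norm h \<le> ell2_norm (kapply (E y) (c y)) + ell2_norm (kapply D (c y))"
      unfolding h_def by (intro ell2_add(2) mem)
    also have "\<dots> \<le> t * ell2_norm (c y) + C' * ell2_norm (c y)"
      by (intro add_mono Ele C' mem)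
    also have "\<dots> \<le> (1 + C') * ell2_norm (c y)"
      using t \<epsilon> mult_right_mono[of t 1 "ell2_norm (c y)"] by (simp add: distrib_right)
    finally have hle: "ell2_norm h \<le> (1 + C') * ell2_norm (c y)" .
    have "ell2_norm (\<lambda>u. c y u - c x u) = ell2_norm (\<lambda>u. (y - x) *\<^sub>R kapply L h u)"
      by (rule ell2_norm_cong) (simp add: diff)
    also have "\<dots> \<le> \<bar>y - x\<bar> * ell2_norm (kapply L h)"
      by (rule ell2_scaleR(2)[OF kapply_ell2[OF bdL h]])
    also have "\<dots> \<le> \<bar>y - x\<bar> * (C * ((1 + C') * ell2_norm (c y)))"
      using C(1) by (intro mult_left_mono order_trans[OF C(2)[OF h]] hle) auto
    finally have dle: "ell2_norm (\<lambda>u. c y u - c x u) \<le> \<bar>y - x\<bar> * M * ell2_norm (c y)"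
      by (simp add: M_def mult.assoc)
    \<comment> \<open>No uniform bound on the resolvents at nearby \<open>y\<close> is given, so the
      norm of \<open>c y\<close> is bounded by moving half of it to the left.\<close>
    have "ell2_norm (c y) \<le> ell2_norm (c x) + ell2_norm (\<lambda>u. c y u - c x u)"
      using ell2_add(2)[OF cx ell2_diff[OF cy cx]] by simp
    also have "ell2_norm (\<lambda>u. c y u - c x u) \<le> 1/2 * ell2_norm (c y)"
      using dle mult_right_mono[OF small ell2_norm_nonneg] order_trans by blast
    finally have cyN: "ell2_norm (c y) \<le> N" by (simp add: N_def)
    have dleN: "ell2_norm (\<lambda>u. c y u - c x u) \<le> \<bar>y - x\<bar> * M * N"
      using dle mult_left_mono[OF cyN, of "\<bar>y - x\<bar> * M"] M by simp
    \<comment> \<open>This is \<open>h\<close> minus \<open>D\<close> applied to \<open>c x\<close>,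
      regrouped into one term small through \<open>E y\<close> and one small through
      \<open>c y - c x\<close>.\<close>
    define k where "k = (\<lambda>u. kapply (E y) (c y) u + kapply D (\<lambda>v. c y v - c x v) u)"
    have k: "k \<in> ell2" unfolding k_def by (intro ell2_add(1) mem kapply_ell2[OF bdD])
    have "(c y a - c x a) /\<^sub>R (y - x) - kapply L (kapply D (c x)) a
        = kapply L (\<lambda>u. h u - kapply D (c x) u) a"
      using y(1) kapply_diff[OF bdL h mem(5) a] by (simp add: diff[OF a])
    also have "\<dots> = kapply L k a"
      by (rule kapply_cong) (simp add: h_def k_def kapply_diff[OF bdD cy cx] add_diff_eq)
    finally have "norm ((c y a - c x a) /\<^sub>R (y - x) - kapply L (kapply D (c x)) a) \<le> C * ell2_norm k"
      using norm_le_ell2_norm[OF kapply_ell2[OF bdL k] a] C(2)[OF k] by simp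
    moreover have "ell2_norm k \<le> \<epsilon> * N + C' * (\<bar>y - x\<bar> * M * N)"
    proof -
      have "ell2_norm k \<le> ell2_norm (kapply (E y) (c y)) + ell2_norm (kapply D (\<lambda>v. c y v - c x v))"
        unfolding k_def by (intro ell2_add(2) mem kapply_ell2[OF bdD])
      also have "\<dots> \<le> t * ell2_norm (c y) + C' * ell2_norm (\<lambda>v. c y v - c x v)"
        by (intro add_mono Ele C'(2) mem)
      also have "\<dots> \<le> \<epsilon> * N + C' * (\<bar>y - x\<bar> * M * N)"
        using t t0 cyN dleN C'(1) by (intro add_mono mult_mono) auto
      finally show ?thesis .
    qed
    ultimately have "norm ((c y a - c x a) /\<^sub>R (y - x) - kapply L (kapply D (c x)) a)
        \<le> C * (\<epsilon> * N + C' * (\<bar>y - x\<bar> * M * N))"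
      using C(1) by (meson mult_left_mono order_trans)
    then show ?thesis by (simp only: ring_distribs mult_ac)
  qed
  have "((\<lambda>y. (c y a - c x a) /\<^sub>R (y - x)) \<longlongrightarrow> kapply L (kapply D (c x)) a) (at x)"
  proof (rule tendstoI)
    fix e :: real assume e: "e > 0"
    \<comment> \<open>The \<open>+ 1\<close> keeps the denominator positive when
      \<open>C * N = 0\<close>; the cap at 1 is what \<open>key\<close> asks for.\<close>
    define \<epsilon> where "\<epsilon> = min 1 (e / (2 * (C * N + 1)))"
    have CN: "C * N \<ge> 0" using C N by simp
    have \<epsilon>: "\<epsilon> > 0" "\<epsilon> \<le> 1" using e CN by (auto simp: \<epsilon>_def add_nonneg_pos)
    have "C * N * \<epsilon> \<le> (C * N + 1) * (e / (2 * (C * N + 1)))"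
      using \<epsilon> CN by (intro mult_mono) (auto simp: \<epsilon>_def)
    also have "\<dots> = e / 2" using CN by (simp add: field_simps)
    finally have \<epsilon>e: "C * \<epsilon> * N \<le> e / 2" by (simp add: mult_ac)
    have "((\<lambda>y. \<bar>y - x\<bar> * M) \<longlongrightarrow> \<bar>x - x\<bar> * M) (at x)" by (intro tendsto_intros)
    then have ev1: "\<forall>\<^sub>F y in at x. \<bar>y - x\<bar> * M < 1/2" by (rule order_tendstoD) simp
    have "((\<lambda>y. C * C' * M * N * \<bar>y - x\<bar>) \<longlongrightarrow> C * C' * M * N * \<bar>x - x\<bar>) (at x)" by (intro tendsto_intros)
    then have ev2: "\<forall>\<^sub>F y in at x. C * C' * M * N * \<bar>y - x\<bar> < e/2" by (rule order_tendstoD) (use e in simp)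
    have "\<forall>\<^sub>F y in at x. y \<noteq> x" by (simp add: eventually_at_filter)
    with ev1 ev2 bd evE[OF \<epsilon>(1)]
    show "\<forall>\<^sub>F y in at x. dist ((c y a - c x a) /\<^sub>R (y - x)) (kapply L (kapply D (c x)) a) < e"
    proof eventually_elim
      case (elim y)
      then obtain t where "t < \<epsilon>" "has_trace_norm (E y) t" by blast
      then have "norm ((c y a - c x a) /\<^sub>R (y - x) - kapply L (kapply D (c x)) a)
          \<le> C * \<epsilon> * N + C * C' * M * N * \<bar>y - x\<bar>"
        using elim \<epsilon> by (intro key) auto
      then show ?case using elim \<epsilon>e by (simp add: dist_norm)
    qed
  qed
  then show ?thesis unfolding has_vector_derivative_at_iff_tendsto L_def .
qed

section \<open>Derivatives of matrices and of their inverses\<close>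

lemma has_vector_derivative_matrixE:
  fixes M :: "real \<Rightarrow> complex ^ 'n::finite ^ 'n"
  assumes d: "\<And>w. ((\<lambda>y. M y *v w) has_vector_derivative d w) (at x)"
  obtains M' where "(M has_vector_derivative M') (at x)" "\<And>w. M' *v w = d w"
proof -
  \<comment> \<open>\<open>T j v\<close> is the matrix with column \<open>j\<close> equal to
    \<open>v\<close> and zeros elsewhere; the derivative is assembled from columns.\<close>
  define T where "T j v = (\<chi> i k. if k = j then v $ i else 0)" for j :: 'n and v :: "complex ^ 'n"
  have T: "bounded_linear (T j)" for j :: 'n
    unfolding linear_conv_bounded_linear[symmetric]
    by (rule linearI) (auto simp: T_def vec_eq_iff)
  have M: "A = (\<Sum>j\<in>UNIV. T j (A *v axis j 1))" for A :: "complex ^ 'n ^ 'n"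
    by (simp add: vec_eq_iff T_def matrix_vector_mult_axis if_distrib cong: if_cong)
  define M' where "M' = (\<Sum>j\<in>UNIV. T j (d (axis j 1)))"
  have "((\<lambda>y. \<Sum>j\<in>UNIV. T j (M y *v axis j 1)) has_vector_derivative M') (at x)"
    unfolding M'_def
    by (intro has_vector_derivative_sum bounded_linear.has_vector_derivative[OF T] d)
  then have M': "(M has_vector_derivative M') (at x)" by (simp flip: M)
  have "bounded_linear (\<lambda>A. A *v w)" for w :: "complex ^ 'n"
    unfolding linear_conv_bounded_linear[symmetric]
    by (rule linearI) (simp_all add: matrix_vector_mult_add_rdistrib matrix_vector_mult_scaleR)
  \<comment> \<open>Uniqueness of derivatives carries the identity from basis vectors to all
    \<open>w\<close>, and thereby shows that \<open>d\<close> is linear.\<close>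
  from bounded_linear.has_vector_derivative[OF this M']
  have "M' *v w = d w" for w
    using d vector_derivative_unique_at by blast
  with M' that show thesis by blast
qed

lemma matrix_inv_mult:
  fixes A :: "complex ^ 'n::finite ^ 'n"
  assumes "invertible A"
  shows "A ** matrix_inv A = mat 1" and "matrix_inv A ** A = mat 1"
proof -
  have "A ** matrix_inv A = mat 1 \<and> matrix_inv A ** A = mat 1"
    unfolding matrix_inv_def by (rule someI_ex) (use assms in \<open>simp add: invertible_def\<close>)
  then show "A ** matrix_inv A = mat 1" "matrix_inv A ** A = mat 1" by auto
qed

lemma tendsto_det:
  fixes M :: "'b \<Rightarrow> complex ^ 'n::finite ^ 'n"
  assumes "(M \<longlongrightarrow> A) F"
  shows "((\<lambda>y. det (M y)) \<longlongrightarrow> det A) F"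
  unfolding det_def by (intro tendsto_intros assms)

text \<open>Cramer's rule writes the entries of the inverse as quotients of determinants, which are
  continuous.\<close>

lemma tendsto_matrix_inv:
  fixes M :: "'b \<Rightarrow> complex ^ 'n::finite ^ 'n"
  assumes M: "(M \<longlongrightarrow> A) F" and A: "invertible A"
  shows "\<forall>\<^sub>F y in F. invertible (M y)"
    and "((\<lambda>y. matrix_inv (M y)) \<longlongrightarrow> matrix_inv A) F"
proof -
  have d: "((\<lambda>y. det (M y)) \<longlongrightarrow> det A) F" by (rule tendsto_det[OF M])
  have dA: "det A \<noteq> 0" using A by (simp add: invertible_det_nz)
  show ev: "\<forall>\<^sub>F y in F. invertible (M y)"
    unfolding invertible_det_nz by (rule tendsto_imp_eventually_ne[OF d dA])
  define X where "X N k j = (\<chi> i l. if l = k then axis j 1 $ i else N $ i $ l)"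
    for N :: "complex ^ 'n ^ 'n" and k j
  have entry: "matrix_inv N $ k $ j = det (X N k j) / det N" if "invertible N" for N k j
  proof -
    have "N *v (matrix_inv N *v axis j 1) = axis j 1"
      using matrix_inv_mult(1)[OF that] by (simp add: matrix_vector_mul_assoc)
    then have "matrix_inv N *v axis j 1 = (\<chi> k. det (X N k j) / det N)"
      using cramer[of N "matrix_inv N *v axis j 1" "axis j 1"] that
      by (simp add: invertible_det_nz X_def)
    then have "(matrix_inv N *v axis j 1) $ k = det (X N k j) / det N" by simp
    then show ?thesis by (simp add: matrix_vector_mult_axis)
  qed
  show "((\<lambda>y. matrix_inv (M y)) \<longlongrightarrow> matrix_inv A) F"
  proof (intro vec_tendstoI)
    fix k j
    have X: "((\<lambda>y. X (M y) k j) \<longlongrightarrow> X A k j) F"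
      unfolding X_def
    proof (intro vec_tendstoI)
      fix i l
      show "((\<lambda>y. (\<chi> i l. if l = k then axis j 1 $ i else M y $ i $ l) $ i $ l) \<longlongrightarrow>
          (\<chi> i l. if l = k then axis j 1 $ i else A $ i $ l) $ i $ l) F"
        by (cases "l = k") (auto intro!: tendsto_intros M)
    qed
    have "((\<lambda>y. det (X (M y) k j) / det (M y)) \<longlongrightarrow> matrix_inv A $ k $ j) F"
      unfolding entry[OF A] by (intro tendsto_divide tendsto_det X M dA)
    \<comment> \<open>The quotient formula is available only where \<open>M y\<close> is invertible,
      that is eventually.\<close>
    then show "((\<lambda>y. matrix_inv (M y) $ k $ j) \<longlongrightarrow> matrix_inv A $ k $ j) F"
      by (rule Lim_transform_eventually) (use ev in \<open>auto elim!: eventually_mono simp: entry\<close>)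
  qed
qed

lemma tendsto_matrix_matrix_mult:
  fixes M :: "'b \<Rightarrow> complex ^ 'n::finite ^ 'n"
  assumes "(M \<longlongrightarrow> A) F" "(N \<longlongrightarrow> B) F"
  shows "((\<lambda>y. M y ** N y) \<longlongrightarrow> A ** B) F"
  unfolding matrix_matrix_mult_def by (intro tendsto_intros tendsto_vec_lambda assms)

lemma matrix_mult_diff:
  fixes A B C :: "complex ^ 'n::finite ^ 'n"
  shows "A ** (B - C) = A ** B - A ** C" and "(A - B) ** C = A ** C - B ** C"
  by (simp_all add: matrix_matrix_mult_def vec_eq_iff algebra_simps sum_subtractf)

lemma matrix_mult_scaleR:
  fixes A B :: "complex ^ 'n::finite ^ 'n"
  shows "A ** (r *\<^sub>R B) = r *\<^sub>R (A ** B)" and "(r *\<^sub>R A) ** B = r *\<^sub>R (A ** B)"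
  by (simp_all add: matrix_matrix_mult_def vec_eq_iff scaleR_sum_right)

text \<open>With \<open>U = N Q\<^sup>-\<^sup>1\<close> one has \<open>N\<^sub>y Q\<^sub>y\<^sup>-\<^sup>1 - U\<^sub>x = ((N\<^sub>y - N\<^sub>x) - U\<^sub>x (Q\<^sub>y - Q\<^sub>x)) Q\<^sub>y\<^sup>-\<^sup>1\<close>, so
  continuity of the inverse suffices.\<close>

lemma has_vector_derivative_matrix_quotient:
  fixes N Q :: "real \<Rightarrow> complex ^ 'n::finite ^ 'n"
  assumes N: "(N has_vector_derivative N') (at x)" and Q: "(Q has_vector_derivative Q') (at x)"
    and inv: "invertible (Q x)"
  shows "((\<lambda>y. N y ** matrix_inv (Q y)) has_vector_derivative
    (N' - N x ** matrix_inv (Q x) ** Q') ** matrix_inv (Q x)) (at x)"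
proof -
  have "(Q \<longlongrightarrow> Q x) (at x)"
    using has_vector_derivative_continuous[OF Q] by (simp add: continuous_within)
  note Qinv = tendsto_matrix_inv[OF this inv]
  define U where "U = N x ** matrix_inv (Q x)"
  have Nx: "N x = U ** Q x"
    unfolding U_def using matrix_inv_mult[OF inv] by (simp flip: matrix_mul_assoc)
  have "((\<lambda>y. ((N y - N x) /\<^sub>R (y - x) - U ** ((Q y - Q x) /\<^sub>R (y - x))) ** matrix_inv (Q y)) \<longlongrightarrow>
      (N' - U ** Q') ** matrix_inv (Q x)) (at x)"
    using N Q unfolding has_vector_derivative_at_iff_tendsto
    by (intro tendsto_matrix_matrix_mult tendsto_diff tendsto_const Qinv)
  then have "((\<lambda>y. (N y ** matrix_inv (Q y) - U) /\<^sub>R (y - x)) \<longlongrightarrow>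
      (N' - U ** Q') ** matrix_inv (Q x)) (at x)"
  proof (rule Lim_transform_eventually)
    have "((N y - N x) /\<^sub>R (y - x) - U ** ((Q y - Q x) /\<^sub>R (y - x))) ** matrix_inv (Q y)
        = (N y ** matrix_inv (Q y) - U) /\<^sub>R (y - x)" if y: "invertible (Q y)" for y
    proof -
      have "U ** Q y ** matrix_inv (Q y) = U"
        using matrix_inv_mult[OF y] by (simp flip: matrix_mul_assoc)
      then show ?thesis
        by (simp add: Nx matrix_mult_diff matrix_mult_scaleR flip: scaleR_diff_right)
    qed
    then show "\<forall>\<^sub>F y in at x. ((N y - N x) /\<^sub>R (y - x) - U ** ((Q y - Q x) /\<^sub>R (y - x))) ** matrix_inv (Q y)
        = (N y ** matrix_inv (Q y) - U) /\<^sub>R (y - x)"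
      using Qinv(1) by (auto elim!: eventually_mono)
  qed
  then show ?thesis
    unfolding has_vector_derivative_at_iff_tendsto U_def .
qed

section \<open>The Toda equation\<close>

text \<open>When \<open>id_minus A\<close> is invertible, this is the square summable solution
  \<open>c\<close> of \<open>(I - A) c = single 1 w\<close>, unique at positive indices. Its first
  entry carries \<open>toda_Q A\<close>.\<close>

definition toda_column :: "'n::finite kernel \<Rightarrow> complex ^ 'n \<Rightarrow> nat \<Rightarrow> complex ^ 'n" where
  "toda_column A w = kapply (kinverse (id_minus A)) (single 1 w)"

lemma toda_column_eq: "toda_column A w u = kinverse (id_minus A) u 1 *v w"
  by (simp add: toda_column_def kapply_single)

lemma toda_column_1: "toda_column A w 1 = toda_Q A *v w"
  unfolding toda_column_eq toda_Q_def ..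

lemma toda_column_ell2: "kinvertible (id_minus A) \<Longrightarrow> toda_column A w \<in> ell2"
  unfolding toda_column_def by (intro kapply_ell2 bounded_kinverse ell2_single)

lemma kapply_toda_column:
  "kinvertible (id_minus A) \<Longrightarrow> u > 0 \<Longrightarrow> kapply (id_minus A) (toda_column A w) u = single 1 w u"
  unfolding toda_column_def by (rule kinverse_right[OF _ ell2_single])

text \<open>The identity kernel is invariant under the diagonal shift, so the block relation passes
  from \<open>A\<close> to \<open>I - A\<close>.\<close>

lemma kapply_id_minus_shift:
  assumes "\<And>u v. u > 0 \<Longrightarrow> v > 0 \<Longrightarrow> B u v = A (u + 1) (v + 1)" and "z 1 = 0" "u > 0"
  shows "kapply (id_minus B) (\<lambda>v. z (Suc v)) u = kapply (id_minus A) z (Suc u)"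
  by (rule kapply_shift[where f=z, OF _ assms(2)]) (use assms in \<open>simp add: id_minus_def\<close>)

text \<open>The row indices are kept separate because the derivative relations compare different
  rows: \<open>u\<close> with \<open>u + 1\<close> for \<eta>, and \<open>u + 1\<close> with
  \<open>u\<close> for \<zeta>.\<close>

lemma kapply_kernel_diff:
  assumes "bounded_kernel A" "bounded_kernel B" "f \<in> ell2" "p > 0" "q > 0"
    and "\<And>v. v > 0 \<Longrightarrow> D u v = A p v - B q v"
  shows "kapply D f u = kapply A f p - kapply B f q"
proof -
  have "((\<lambda>v. A p v *v f v + - (B q v *v f v)) has_sum (kapply A f p + - kapply B f q)) {0<..}"
    unfolding kapply_def using assms
    by (intro has_sum_add has_sum_infsum) (auto simp: has_sum_uminus bounded_kernel_summable)
  then have "((\<lambda>v. D u v *v f v) has_sum (kapply A f p - kapply B f q)) {0<..}"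
    by (subst has_sum_cong[where g="\<lambda>v. A p v *v f v + - (B q v *v f v)"])
      (auto simp: assms(6) matrix_vector_mult_diff_rdistrib)
  then show ?thesis unfolding kapply_def by (rule infsumI)
qed

text \<open>\<open>I - A\<close> has lower right block \<open>I - B\<close>, and \<open>toda_Q A\<close> is the inverse of the corresponding
  Schur complement.\<close>

lemma invertible_toda_Q:
  assumes A: "bounded_kernel A" "kinvertible (id_minus A)"
    and B: "kinvertible (id_minus B)"
    and shift: "\<And>u v. u > 0 \<Longrightarrow> v > 0 \<Longrightarrow> B u v = A (u + 1) (v + 1)"
  shows "invertible (toda_Q A)"
proof -
  \<comment> \<open>If \<open>toda_Q A\<close> kills \<open>w\<close>, the column of
    \<open>A\<close> for \<open>w\<close> starts with 0; its tail then solves the homogeneous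
    equation for \<open>B\<close>, so the column and finally \<open>w\<close> vanish.\<close>
  have "w = 0" if w: "toda_Q A *v w = 0" for w
  proof -
    define c where "c = toda_column A w"
    have c: "c \<in> ell2" unfolding c_def by (rule toda_column_ell2[OF A(2)])
    have c1: "c 1 = 0" unfolding c_def toda_column_1 w ..
    have "c (Suc u) = 0" if "u > 0" for u
    proof -
      have "kapply (kinverse (id_minus B)) (\<lambda>_. 0) u = c (Suc u)"
      proof (rule kinverse_eqI[OF B ell2_Suc[OF c] _ that])
        fix v :: nat assume v: "v > 0"
        show "kapply (id_minus B) (\<lambda>v. c (Suc v)) v = 0"
          using kapply_toda_column[OF A(2), of "Suc v" w] v
          by (simp add: kapply_id_minus_shift[where A=A and z=c, OF shift c1 v] single_def flip: c_def)
      qed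
      then show ?thesis by (simp add: kapply_def)
    qed
    with c1 have c0: "c u = 0" if "u > 0" for u
      using that by (metis One_nat_def gr0_conv_Suc neq0_conv)
    have "w = kapply (id_minus A) c 1"
      using kapply_toda_column[OF A(2), of 1 w] by (simp add: c_def single_def)
    also have "\<dots> = kapply (id_minus A) (\<lambda>_. 0) 1"
      by (rule kapply_cong) (simp add: c0)
    finally show "w = 0" by (simp add: kapply_def)
  qed
  then show ?thesis
    unfolding invertible_left_inverse matrix_left_invertible_ker by blast
qed

text \<open>The ratio of the second to the first entry of the first resolvent column: if
  \<open>toda_Q A\<close> is invertible, it sends the first entry of each
  \<open>toda_column A w\<close> to the second.\<close>

definition toda_U :: "'n::finite kernel \<Rightarrow> complex ^ 'n ^ 'n" where
  "toda_U A = kinverse (id_minus A) 2 1 ** matrix_inv (toda_Q A)"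

lemma toda_column_2: "toda_column A w (Suc 1) = kinverse (id_minus A) 2 1 *v w"
  unfolding toda_column_eq by (simp add: numeral_2_eq_2)

section \<open>Resolvent identities between neighbouring levels\<close>

text \<open>Here \<open>A\<close> is one level below \<open>B\<close>. Columns of \<open>A\<close>
  and \<open>B\<close> with equal first entries have a difference whose tail solves the equation for
  \<open>B\<close> with right-hand side \<open>D b\<close>; the value sought is the second entry of
  that difference.\<close>

lemma toda_Q_resolvent_eta:
  assumes A: "bounded_kernel A" "kinvertible (id_minus A)"
    and B: "bounded_kernel B" "kinvertible (id_minus B)"
    and shift: "\<And>u v. u > 0 \<Longrightarrow> v > 0 \<Longrightarrow> B u v = A (u + 1) (v + 1)"
    and D: "\<And>u v. u > 0 \<Longrightarrow> v > 0 \<Longrightarrow> D u v = A (u + 1) v - B (u + 1) v"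
  shows "kapply (kinverse (id_minus B)) (kapply D (toda_column B w)) 1
    = (toda_U A ** toda_Q B - kinverse (id_minus B) 2 1) *v w"
proof -
  \<comment> \<open>Chosen so that \<open>toda_Q A *v w' = toda_Q B *v w\<close>, which makes the
    first entries of \<open>a\<close> and \<open>b\<close> agree.\<close>
  define w' where "w' = matrix_inv (toda_Q A) *v (toda_Q B *v w)"
  define b where "b = toda_column B w"
  define a where "a = toda_column A w'"
  have a: "a \<in> ell2" unfolding a_def by (rule toda_column_ell2[OF A(2)])
  have b: "b \<in> ell2" unfolding b_def by (rule toda_column_ell2[OF B(2)])
  have "a 1 = b 1"
    using matrix_inv_mult(1)[OF invertible_toda_Q[OF A B(2) shift]]
    by (simp add: a_def b_def toda_column_1[unfolded One_nat_def] w'_def matrix_vector_mul_assoc matrix_mul_assoc)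
  then have z: "a 1 - b 1 = 0" by simp
  have "kapply (kinverse (id_minus B)) (kapply D b) 1 = a (Suc 1) - b (Suc 1)"
  proof (rule kinverse_eqI[OF B(2) ell2_Suc[OF ell2_diff[OF a b]]])
    fix u :: nat assume u: "u > 0"
    have "kapply (id_minus B) (\<lambda>v. a (Suc v) - b (Suc v)) u = kapply (id_minus A) (\<lambda>v. a v - b v) (Suc u)"
      by (rule kapply_id_minus_shift[where A=A and z="\<lambda>v. a v - b v", OF shift z u])
    also have "\<dots> = kapply (id_minus A) a (Suc u) - kapply (id_minus A) b (Suc u)"
      using A(2) by (intro kapply_diff a b) (auto simp: kinvertible_def)
    \<comment> \<open>Both sides are 0, since \<open>single\<close> is supported at 1 and
      \<open>Suc u\<close> is at least 2.\<close>
    also have "kapply (id_minus A) a (Suc u) = kapply (id_minus B) b (Suc u)"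
      using u by (simp add: a_def b_def kapply_toda_column A B single_def)
    also have "kapply (id_minus B) b (Suc u) - kapply (id_minus A) b (Suc u)
        = kapply A b (Suc u) - kapply B b (Suc u)"
      by (simp add: kapply_id_minus A B b)
    also have "\<dots> = kapply D b u"
      using kapply_kernel_diff[OF A(1) B(1) b, of "Suc u" "Suc u" D u] D u by simp
    finally show "kapply (id_minus B) (\<lambda>v. a (Suc v) - b (Suc v)) u = kapply D b u" .
  qed simp
  also have "\<dots> = (toda_U A ** toda_Q B - kinverse (id_minus B) 2 1) *v w"
    unfolding a_def b_def toda_column_2 w'_def toda_U_def
    by (simp add: matrix_vector_mul_assoc matrix_mul_assoc matrix_vector_mult_diff_rdistrib)
  finally show ?thesis unfolding b_def .
qed

text \<open>Here \<open>B\<close> is one level above \<open>A\<close>, and \<open>d w\<close> is the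
  resolvent expression for the derivative of the first column. Subtracting a column \<open>e\<close>
  of \<open>A\<close> with the same first entry leaves \<open>z\<close>, whose tail is the
  difference of the first columns of \<open>A\<close> and \<open>B\<close>.\<close>

lemma toda_U_resolvent_zeta:
  assumes A: "bounded_kernel A" "kinvertible (id_minus A)"
    and B: "bounded_kernel B" "kinvertible (id_minus B)"
    and shift: "\<And>u v. u > 0 \<Longrightarrow> v > 0 \<Longrightarrow> B u v = A (u + 1) (v + 1)"
    and bdD: "bounded_kernel D"
    and D: "\<And>u v. u > 0 \<Longrightarrow> v > 0 \<Longrightarrow> D (u + 1) v = A u v - B u v"
  defines "d \<equiv> \<lambda>w. kapply (kinverse (id_minus A)) (kapply D (toda_column A w))"
  shows "d w 2 - toda_U A *v d w 1 = (toda_Q A - toda_Q B) *v w"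
proof -
  define c where "c = toda_column A w"
  have c: "c \<in> ell2" unfolding c_def by (rule toda_column_ell2[OF A(2)])
  have Dc: "kapply D c \<in> ell2" by (rule kapply_ell2[OF bdD c])
  have dw: "d w = kapply (kinverse (id_minus A)) (kapply D c)" by (simp add: d_def c_def)
  have d: "d w \<in> ell2" unfolding dw by (rule kapply_ell2[OF bounded_kinverse[OF A(2)] Dc])
  have bdA: "bounded_kernel (id_minus A)" and bdB: "bounded_kernel (id_minus B)"
    using A B by (auto simp: kinvertible_def)
  \<comment> \<open>Besides matching \<open>d w\<close> at 1, \<open>e\<close> is annihilated by
    \<open>id_minus A\<close> in all rows from 2 on, so it leaves the equation for the tail
    unchanged.\<close>
  define e where "e = toda_column A (matrix_inv (toda_Q A) *v d w 1)"
  have e: "e \<in> ell2" unfolding e_def by (rule toda_column_ell2[OF A(2)])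
  define z where "z = (\<lambda>u. d w u - e u)"
  have z: "z \<in> ell2" unfolding z_def by (rule ell2_diff[OF d e])
  have "e 1 = d w 1"
    using matrix_inv_mult(1)[OF invertible_toda_Q[OF A B(2) shift]]
    by (simp add: e_def toda_column_1[unfolded One_nat_def] matrix_vector_mul_assoc)
  then have z1: "z 1 = 0" by (simp add: z_def)
  have "toda_column B w 1 = c 1 - z (Suc 1)"
    unfolding toda_column_def
  proof (rule kinverse_eqI[OF B(2) ell2_diff[OF c ell2_Suc[OF z]]])
    fix u :: nat assume u: "u > 0"
    have "kapply (id_minus B) (\<lambda>v. z (Suc v)) u = kapply (id_minus A) z (Suc u)"
      by (rule kapply_id_minus_shift[where A=A and z=z, OF shift z1 u])
    also have "\<dots> = kapply (id_minus A) (d w) (Suc u) - kapply (id_minus A) e (Suc u)"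
      unfolding z_def by (intro kapply_diff d e bdA) simp
    also have "kapply (id_minus A) e (Suc u) = 0"
      using u by (simp add: e_def kapply_toda_column A single_def)
    also have "kapply (id_minus A) (d w) (Suc u) = kapply D c (Suc u)"
      unfolding dw by (rule kinverse_right[OF A(2) Dc]) simp
    also have "\<dots> = kapply A c u - kapply B c u"
      using D u by (intro kapply_kernel_diff A B c) auto
    also have "\<dots> = kapply (id_minus B) c u - kapply (id_minus A) c u"
      by (simp add: kapply_id_minus A B c u)
    also have "kapply (id_minus A) c u = single 1 w u"
      unfolding c_def by (rule kapply_toda_column[OF A(2) u])
    finally show "kapply (id_minus B) (\<lambda>v. c v - z (Suc v)) u = single 1 w u"
      using kapply_diff[OF bdB c ell2_Suc[OF z] u] by simp
  qed simp
  \<comment> \<open>The second entry of \<open>e\<close> is \<open>toda_U A\<close> applied to its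
    first entry \<open>d w 1\<close>, which gives the claim.\<close>
  then have "d w (Suc 1) - e (Suc 1) = toda_Q A *v w - toda_Q B *v w"
    unfolding toda_column_1 c_def z_def by (simp add: algebra_simps)
  then show ?thesis
    unfolding e_def toda_column_2 toda_U_def
    by (simp add: matrix_vector_mul_assoc matrix_vector_mult_diff_rdistrib numeral_2_eq_2)
qed

section \<open>Derivatives of \<open>toda_Q\<close> and \<open>toda_U\<close>\<close>

lemma kinverse_entry_derivativeE:
  fixes F :: "real \<Rightarrow> 'n::finite kernel"
  assumes "has_trace_norm_derivative F D x"
    and "\<forall>\<^sub>F y in at x. bounded_kernel (F y) \<and> kinvertible (id_minus (F y))"
    and "bounded_kernel (F x)" "kinvertible (id_minus (F x))" "a > 0"
  obtains M' where "((\<lambda>y. kinverse (id_minus (F y)) a 1) has_vector_derivative M') (at x)"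
    "\<And>w. M' *v w = kapply (kinverse (id_minus (F x))) (kapply D (toda_column (F x) w)) a"
proof -
  have "((\<lambda>y. kinverse (id_minus (F y)) a 1 *v w) has_vector_derivative
      kapply (kinverse (id_minus (F x))) (kapply D (toda_column (F x) w)) a) (at x)" for w
    using kinverse_has_vector_derivative[OF assms(1-4) ell2_single[of 1 w] assms(5)]
    unfolding toda_column_def[symmetric] toda_column_eq .
  from has_vector_derivative_matrixE[OF this] that show thesis by blast
qed

lemma toda_Q_has_vector_derivative:
  fixes F :: "real \<Rightarrow> 'n::finite kernel"
  assumes der: "has_trace_norm_derivative F D x"
    and ev: "\<forall>\<^sub>F y in at x. bounded_kernel (F y) \<and> kinvertible (id_minus (F y))"
    and Fx: "bounded_kernel (F x)" "kinvertible (id_minus (F x))"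
    and A: "bounded_kernel A" "kinvertible (id_minus A)"
    and shift: "\<And>u v. u > 0 \<Longrightarrow> v > 0 \<Longrightarrow> F x u v = A (u + 1) (v + 1)"
    and D: "\<And>u v. u > 0 \<Longrightarrow> v > 0 \<Longrightarrow> D u v = A (u + 1) v - F x (u + 1) v"
  shows "((\<lambda>y. toda_Q (F y)) has_vector_derivative
    toda_U A ** toda_Q (F x) - kinverse (id_minus (F x)) 2 1) (at x)"
proof -
  obtain M' where M': "((\<lambda>y. kinverse (id_minus (F y)) 1 1) has_vector_derivative M') (at x)"
    "\<And>w. M' *v w = kapply (kinverse (id_minus (F x))) (kapply D (toda_column (F x) w)) 1"
    using kinverse_entry_derivativeE[OF der ev Fx, of 1] by auto
  have "M' = toda_U A ** toda_Q (F x) - kinverse (id_minus (F x)) 2 1"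
    unfolding matrix_eq M'(2) by (intro allI toda_Q_resolvent_eta A Fx shift D)
  with M'(1) show ?thesis by (simp add: toda_Q_def)
qed

text \<open>With \<open>N\<close> the \<open>(2, 1)\<close> block of the resolvent and
  \<open>Q\<close> its \<open>(1, 1)\<close> block, the quotient rule gives
  \<open>(N' - U Q') Q^-1\<close>; the resolvent identity evaluates the bracket to
  \<open>toda_Q (F x) - toda_Q B\<close>.\<close>

lemma toda_U_has_vector_derivative:
  fixes F :: "real \<Rightarrow> 'n::finite kernel"
  assumes der: "has_trace_norm_derivative F D x"
    and ev: "\<forall>\<^sub>F y in at x. bounded_kernel (F y) \<and> kinvertible (id_minus (F y))"
    and Fx: "bounded_kernel (F x)" "kinvertible (id_minus (F x))"
    and B: "bounded_kernel B" "kinvertible (id_minus B)"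
    and shift: "\<And>u v. u > 0 \<Longrightarrow> v > 0 \<Longrightarrow> B u v = F x (u + 1) (v + 1)"
    and D: "\<And>u v. u > 0 \<Longrightarrow> v > 0 \<Longrightarrow> D (u + 1) v = F x u v - B u v"
  shows "((\<lambda>y. toda_U (F y)) has_vector_derivative
    mat 1 - toda_Q B ** matrix_inv (toda_Q (F x))) (at x)"
proof -
  let ?d = "\<lambda>w. kapply (kinverse (id_minus (F x))) (kapply D (toda_column (F x) w))"
  obtain Q' where Q': "((\<lambda>y. kinverse (id_minus (F y)) 1 1) has_vector_derivative Q') (at x)"
    "\<And>w. Q' *v w = ?d w 1"
    using kinverse_entry_derivativeE[OF der ev Fx, of 1] by auto
  obtain N' where N': "((\<lambda>y. kinverse (id_minus (F y)) 2 1) has_vector_derivative N') (at x)"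
    "\<And>w. N' *v w = ?d w 2"
    using kinverse_entry_derivativeE[OF der ev Fx, of 2] by auto
  have bdD: "bounded_kernel D"
    using der by (simp add: has_trace_norm_derivative_def trace_class_imp_bounded)
  have inv: "invertible (toda_Q (F x))"
    by (rule invertible_toda_Q[OF Fx B(2) shift])
  have "N' - toda_U (F x) ** Q' = toda_Q (F x) - toda_Q B"
    unfolding matrix_eq
    using toda_U_resolvent_zeta[OF Fx B shift bdD D]
    by (simp add: matrix_vector_mult_diff_rdistrib N'(2) Q'(2) flip: matrix_vector_mul_assoc)
  moreover have "((\<lambda>y. toda_U (F y)) has_vector_derivative
      (N' - toda_U (F x) ** Q') ** matrix_inv (toda_Q (F x))) (at x)"
    unfolding toda_U_def
    by (rule has_vector_derivative_matrix_quotient[OF N'(1) Q'(1)[folded toda_Q_def] inv])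
  ultimately show ?thesis
    by (simp add: matrix_mult_diff matrix_inv_mult[OF inv])
qed

theorem theorem3p1:
  fixes lo hi :: int
    and \<Omega> :: "(real \<times> real) set"
    and K :: "int \<Rightarrow> real \<Rightarrow> real \<Rightarrow> 'n::finite kernel"
  assumes "lo < hi - 1"
    and "open \<Omega>"
    and shift: "\<And>r \<eta> \<zeta> u v. \<lbrakk>r \<in> {lo..hi - 1}; (\<eta>, \<zeta>) \<in> \<Omega>; u > 0; v > 0\<rbrakk> \<Longrightarrow>
      K (r + 1) \<eta> \<zeta> u v = K r \<eta> \<zeta> (u + 1) (v + 1)"
    and d_eta: "\<And>r \<eta> \<zeta> u v. \<lbrakk>r \<in> {lo + 1..hi}; (\<eta>, \<zeta>) \<in> \<Omega>; u > 0; v > 0\<rbrakk> \<Longrightarrow>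
      ((\<lambda>s. K r s \<zeta> u v) has_vector_derivative
         K (r - 1) \<eta> \<zeta> (u + 1) v - K r \<eta> \<zeta> (u + 1) v) (at \<eta>)"
    and d_zeta: "\<And>r \<eta> \<zeta> u v. \<lbrakk>r \<in> {lo + 1..hi}; (\<eta>, \<zeta>) \<in> \<Omega>; u > 0; v > 0\<rbrakk> \<Longrightarrow>
      ((\<lambda>t. K r \<eta> t u v) has_vector_derivative
         K (r - 1) \<eta> \<zeta> u (v + 1) - K r \<eta> \<zeta> u (v + 1)) (at \<zeta>)"
    and trace_class: "\<And>r \<eta> \<zeta>. \<lbrakk>r \<in> {lo..hi}; (\<eta>, \<zeta>) \<in> \<Omega>\<rbrakk> \<Longrightarrow> trace_class (K r \<eta> \<zeta>)"
    and trace_norm_d_eta: "\<And>r \<eta> \<zeta>. \<lbrakk>r \<in> {lo..hi}; (\<eta>, \<zeta>) \<in> \<Omega>\<rbrakk> \<Longrightarrow>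
      \<exists>D. has_trace_norm_derivative (\<lambda>s. K r s \<zeta>) D \<eta>"
    and trace_norm_d_zeta: "\<And>r \<eta> \<zeta>. \<lbrakk>r \<in> {lo..hi}; (\<eta>, \<zeta>) \<in> \<Omega>\<rbrakk> \<Longrightarrow>
      \<exists>D. has_trace_norm_derivative (\<lambda>t. K r \<eta> t) D \<zeta>"
    and invertible: "\<And>r \<eta> \<zeta>. \<lbrakk>r \<in> {lo..hi}; (\<eta>, \<zeta>) \<in> \<Omega>\<rbrakk> \<Longrightarrow> kinvertible (id_minus (K r \<eta> \<zeta>))"
  shows "(\<forall>r\<in>{lo..hi - 1}. \<forall>(\<eta>, \<zeta>)\<in>\<Omega>. invertible (toda_Q (K r \<eta> \<zeta>))) \<and>
    (\<forall>r\<in>{lo + 1..hi - 1}. \<forall>(\<eta>, \<zeta>)\<in>\<Omega>.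
       (r = lo + 1 \<longrightarrow> zeta_relation_at_bottom (K lo) \<eta> \<zeta>) \<longrightarrow>
       (let Q = (\<lambda>r \<eta> \<zeta>. toda_Q (K r \<eta> \<zeta>));
            dQ = (\<lambda>\<eta> \<zeta>. vector_derivative (\<lambda>s. Q r s \<zeta>) (at \<eta>));
            W = (\<lambda>\<eta> \<zeta>. dQ \<eta> \<zeta> ** matrix_inv (Q r \<eta> \<zeta>))
        in (\<lambda>s. Q r s \<zeta>) differentiable at \<eta> \<and>
           (\<lambda>t. W \<eta> t) differentiable at \<zeta> \<and>
           vector_derivative (\<lambda>t. W \<eta> t) (at \<zeta>)
             + Q r \<eta> \<zeta> ** matrix_inv (Q (r - 1) \<eta> \<zeta>)
             - Q (r + 1) \<eta> \<zeta> ** matrix_inv (Q r \<eta> \<zeta>) = 0))"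
proof -
  have bdd: "bounded_kernel (K r \<eta> \<zeta>)" if "r \<in> {lo..hi}" "(\<eta>, \<zeta>) \<in> \<Omega>" for r \<eta> \<zeta>
    by (rule trace_class_imp_bounded[OF trace_class[OF that]])
  have inv: "invertible (toda_Q (K r \<eta> \<zeta>))" if r: "r \<in> {lo..hi - 1}" and p: "(\<eta>, \<zeta>) \<in> \<Omega>" for r \<eta> \<zeta>
  proof (rule invertible_toda_Q)
    show "K (r + 1) \<eta> \<zeta> u v = K r \<eta> \<zeta> (u + 1) (v + 1)" if "u > 0" "v > 0" for u v
      by (rule shift[OF r p that])
  qed (use r p in \<open>auto intro!: bdd invertible\<close>)
  have near_eta: "\<forall>\<^sub>F s in nhds \<eta>. (s, \<zeta>) \<in> \<Omega>" and near_zeta: "\<forall>\<^sub>F t in nhds \<zeta>. (\<eta>, t) \<in> \<Omega>"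
    if "(\<eta>, \<zeta>) \<in> \<Omega>" for \<eta> \<zeta>
  proof -
    have "((\<lambda>s. (s, \<zeta>)) \<longlongrightarrow> (\<eta>, \<zeta>)) (nhds \<eta>)" "((\<lambda>t. (\<eta>, t)) \<longlongrightarrow> (\<eta>, \<zeta>)) (nhds \<zeta>)"
      by (intro tendsto_intros filterlim_ident)+
    then show "\<forall>\<^sub>F s in nhds \<eta>. (s, \<zeta>) \<in> \<Omega>" "\<forall>\<^sub>F t in nhds \<zeta>. (\<eta>, t) \<in> \<Omega>"
      using topological_tendstoD[OF _ \<open>open \<Omega>\<close> that] by blast+
  qed
  have dQ: "((\<lambda>s. toda_Q (K r s \<zeta>)) has_vector_derivative
      toda_U (K (r - 1) \<eta> \<zeta>) ** toda_Q (K r \<eta> \<zeta>) - kinverse (id_minus (K r \<eta> \<zeta>)) 2 1) (at \<eta>)"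
    if r: "r \<in> {lo + 1..hi - 1}" and p: "(\<eta>, \<zeta>) \<in> \<Omega>" for r \<eta> \<zeta>
  proof -
    have r': "r \<in> {lo..hi}" "r \<in> {lo + 1..hi}" "r - 1 \<in> {lo..hi}" "r - 1 \<in> {lo..hi - 1}" using r by auto
    obtain D where D: "has_trace_norm_derivative (\<lambda>s. K r s \<zeta>) D \<eta>"
      using trace_norm_d_eta[OF r'(1) p] by blast
    show ?thesis
    proof (rule toda_Q_has_vector_derivative[OF D])
      show "\<forall>\<^sub>F s in at \<eta>. bounded_kernel (K r s \<zeta>) \<and> kinvertible (id_minus (K r s \<zeta>))"
        using near_eta[OF p] r'(1)
        by (auto simp: eventually_at_filter elim!: eventually_mono intro: bdd invertible)
      show "K r \<eta> \<zeta> u v = K (r - 1) \<eta> \<zeta> (u + 1) (v + 1)" if "u > 0" "v > 0" for u v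
        using shift[OF r'(4) p that] by simp
      \<comment> \<open>The trace norm derivative is given only as some \<open>D\<close>; uniqueness
        of entrywise derivatives makes it the kernel of the \<eta>-relation.\<close>
      show "D u v = K (r - 1) \<eta> \<zeta> (u + 1) v - K r \<eta> \<zeta> (u + 1) v" if "u > 0" "v > 0" for u v
        by (rule vector_derivative_unique_at[OF has_trace_norm_derivative_entry[OF D that] d_eta[OF r'(2) p that]])
    qed (use r' p in \<open>auto intro!: bdd invertible\<close>)
  qed
  have dU: "((\<lambda>t. toda_U (K r \<eta> t)) has_vector_derivative
      mat 1 - toda_Q (K (r + 1) \<eta> \<zeta>) ** matrix_inv (toda_Q (K r \<eta> \<zeta>))) (at \<zeta>)"
    if r: "r \<in> {lo..hi - 1}" and p: "(\<eta>, \<zeta>) \<in> \<Omega>"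
      and bot: "r = lo \<Longrightarrow> zeta_relation_at_bottom (K lo) \<eta> \<zeta>" for r \<eta> \<zeta>
  proof -
    have r': "r \<in> {lo..hi}" "r + 1 \<in> {lo..hi}" using r by auto
    obtain D where D: "has_trace_norm_derivative (\<lambda>t. K r \<eta> t) D \<zeta>"
      using trace_norm_d_zeta[OF r'(1) p] by blast
    \<comment> \<open>Above the bottom, two shifts rewrite the \<zeta>-relation so that only levels
      \<open>r\<close> and \<open>r + 1\<close> occur; at \<open>r = lo\<close> the extra relation
      already has this form up to one shift.\<close>
    have rel: "((\<lambda>t. K r \<eta> t (u + 1) v) has_vector_derivative
        K r \<eta> \<zeta> u v - K (r + 1) \<eta> \<zeta> u v) (at \<zeta>)" if uv: "u > 0" "v > 0" for u v
    proof (cases "r = lo")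
      case True
      then show ?thesis
        using bot uv shift[OF r p uv] by (simp add: zeta_relation_at_bottom_def)
    next
      case False
      then have r'': "r \<in> {lo + 1..hi}" "r - 1 \<in> {lo..hi - 1}" using r by auto
      show ?thesis
        using d_zeta[OF r''(1) p, of "u + 1" v] uv shift[OF r''(2) p uv] shift[OF r p uv] by simp
    qed
    show ?thesis
    proof (rule toda_U_has_vector_derivative[OF D])
      show "\<forall>\<^sub>F t in at \<zeta>. bounded_kernel (K r \<eta> t) \<and> kinvertible (id_minus (K r \<eta> t))"
        using near_zeta[OF p] r'(1)
        by (auto simp: eventually_at_filter elim!: eventually_mono intro: bdd invertible)
      show "K (r + 1) \<eta> \<zeta> u v = K r \<eta> \<zeta> (u + 1) (v + 1)" if "u > 0" "v > 0" for u v
        by (rule shift[OF r p that])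
      show "D (u + 1) v = K r \<eta> \<zeta> u v - K (r + 1) \<eta> \<zeta> u v" if "u > 0" "v > 0" for u v
        by (rule vector_derivative_unique_at[OF has_trace_norm_derivative_entry[OF D _ that(2)] rel[OF that]]) simp
    qed (use r' p in \<open>auto intro!: bdd invertible\<close>)
  qed
  have toda: "(\<lambda>s. toda_Q (K r s \<zeta>)) differentiable at \<eta> \<and> (\<lambda>t. W \<eta> t) differentiable at \<zeta> \<and>
      vector_derivative (\<lambda>t. W \<eta> t) (at \<zeta>)
        + toda_Q (K r \<eta> \<zeta>) ** matrix_inv (toda_Q (K (r - 1) \<eta> \<zeta>))
        - toda_Q (K (r + 1) \<eta> \<zeta>) ** matrix_inv (toda_Q (K r \<eta> \<zeta>)) = 0"
    if r: "r \<in> {lo + 1..hi - 1}" and p: "(\<eta>, \<zeta>) \<in> \<Omega>"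
      and bot: "r = lo + 1 \<longrightarrow> zeta_relation_at_bottom (K lo) \<eta> \<zeta>"
      and W: "W = (\<lambda>\<eta> \<zeta>. vector_derivative (\<lambda>s. toda_Q (K r s \<zeta>)) (at \<eta>) ** matrix_inv (toda_Q (K r \<eta> \<zeta>)))"
    for r \<eta> \<zeta> W
  proof -
    have r': "r \<in> {lo..hi - 1}" "r - 1 \<in> {lo..hi - 1}" "r \<noteq> lo" using r by auto
    \<comment> \<open>Only the \<eta>-derivative enters, so this holds at every \<open>t\<close>
      with \<open>(\<eta>, t)\<close> in \<open>\<Omega>\<close>, as differentiation in
      \<open>t\<close> requires.\<close>
    have W_eq: "W \<eta> t = toda_U (K (r - 1) \<eta> t) - toda_U (K r \<eta> t)" if t: "(\<eta>, t) \<in> \<Omega>" for t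
      unfolding W vector_derivative_at[OF dQ[OF r t]] matrix_mult_diff toda_U_def[of "K r \<eta> t"]
      using matrix_inv_mult(1)[OF inv[OF r'(1) t]] by (simp flip: matrix_mul_assoc)
    \<comment> \<open>The bottom relation enters through level \<open>r - 1\<close>, which is
      \<open>lo\<close> when \<open>r = lo + 1\<close>. The two identity matrices cancel.\<close>
    have "((\<lambda>t. toda_U (K (r - 1) \<eta> t) - toda_U (K r \<eta> t)) has_vector_derivative
        (mat 1 - toda_Q (K (r - 1 + 1) \<eta> \<zeta>) ** matrix_inv (toda_Q (K (r - 1) \<eta> \<zeta>)))
        - (mat 1 - toda_Q (K (r + 1) \<eta> \<zeta>) ** matrix_inv (toda_Q (K r \<eta> \<zeta>)))) (at \<zeta>)"
      using bot r' by (intro has_vector_derivative_diff dU p) auto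
    \<comment> \<open>Openness gives a neighbourhood of \<zeta> on which \<open>W_eq\<close> holds,
      so the derivative transfers to \<open>W \<eta>\<close>.\<close>
    then have "(W \<eta> has_vector_derivative
        (mat 1 - toda_Q (K (r - 1 + 1) \<eta> \<zeta>) ** matrix_inv (toda_Q (K (r - 1) \<eta> \<zeta>)))
        - (mat 1 - toda_Q (K (r + 1) \<eta> \<zeta>) ** matrix_inv (toda_Q (K r \<eta> \<zeta>)))) (at \<zeta>)"
      using near_zeta[OF p] unfolding eventually_nhds
      by (auto intro: has_vector_derivative_transform_within_open simp: W_eq)
    then show ?thesis
      using dQ[OF r p] by (auto simp: vector_derivative_at intro: differentiableI_vector)
  qed
  show ?thesis
    unfolding Let_def using inv toda[OF _ _ _ refl] by blast
qed

end
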